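(* Let $M$ be a complete metric space. The Lipschitz-free space $\mathcal{F}(M)$ has the Schur property if and only if $\mathcal{F}(K)$ has the Schur property for every compact $K\subset M$.
   Context: All metric spaces come with a distinguished base point $0$. $\mathrm{Lip}_0(M)$ is the Banach space of real-valued Lipschitz functions $f$ on $M$ with $f(0)=0$, normed by the best Lipschitz constant. For $x\in M$ let $\delta(x)\in\mathrm{Lip}_0(M)^*$ be $\delta(x)(f)=f(x)$. The Lipschitz-free space is $\mathcal{F}(M)=\overline{\operatorname{span}}\{\delta(x):x\in M\}\subset\mathrm{Lip}_0(M)^*$ (norm closure). For $N\subset M$, $\mathcal{F}(N)$ is identified with the closed subspace $\overline{\operatorname{span}}\{\delta(x):x\in N\}$ of $\mathcal{F}(M)$ (canonically isometric to the free space over $N\cup\{0\}$). A Banach space has the Schur property if every weakly null sequence in it converges to $0$ in norm. *)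

theory Defs
  imports "HOL-Analysis.Analysis"
begin

class pointed_metric_space = metric_space +
  fixes base_point :: 'a

(* The vector space Lip_0(M) for M = UNIV :: 'a set. *)

typedef (overloaded) 'a lip0 =
  "{f :: 'a::pointed_metric_space \<Rightarrow> real. f base_point = 0 \<and> (\<exists>L. L-lipschitz_on UNIV f)}"
  morphisms lip0_apply Lip0
proof (intro exI CollectI conjI)
  show "0-lipschitz_on UNIV (\<lambda>_::'a. 0::real)"
    by (simp add: lipschitz_on_def)
qed simp

setup_lifting type_definition_lip0

lemma lip0_apply_base_point [simp]: "lip0_apply f base_point = 0"
  using lip0_apply[of f] by simp

lemma lip0_lipschitz_ex: "\<exists>L. L-lipschitz_on UNIV (lip0_apply f)"
  using lip0_apply[of f] by simp

lemma lip0_eqI: "(\<And>x. lip0_apply f x = lip0_apply g x) \<Longrightarrow> f = g"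
  by (simp add: lip0_apply_inject[symmetric] ext)

instantiation lip0 :: (pointed_metric_space) real_vector
begin

lift_definition zero_lip0 :: "'a lip0" is "\<lambda>_. 0"
  by (auto intro!: exI[of _ 0] simp: lipschitz_on_def)

lift_definition plus_lip0 :: "'a lip0 \<Rightarrow> 'a lip0 \<Rightarrow> 'a lip0" is "\<lambda>f g x. f x + g x"
  by (auto intro: lipschitz_on_add)

lift_definition minus_lip0 :: "'a lip0 \<Rightarrow> 'a lip0 \<Rightarrow> 'a lip0" is "\<lambda>f g x. f x - g x"
  by (auto intro: lipschitz_on_diff)

lift_definition uminus_lip0 :: "'a lip0 \<Rightarrow> 'a lip0" is "\<lambda>f x. - f x"
  by (auto intro: lipschitz_on_minus)

lift_definition scaleR_lip0 :: "real \<Rightarrow> 'a lip0 \<Rightarrow> 'a lip0" is "\<lambda>c f x. c * f x"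
  by (auto intro: lipschitz_on_cmult_real)

instance
  by standard (transfer; simp add: fun_eq_iff algebra_simps)+

end

instantiation lip0 :: (pointed_metric_space) real_normed_vector
begin

(* the best Lipschitz constant *)
definition norm_lip0 :: "'a lip0 \<Rightarrow> real"
  where "norm_lip0 f = Inf {L. L-lipschitz_on UNIV (lip0_apply f)}"

definition dist_lip0 :: "'a lip0 \<Rightarrow> 'a lip0 \<Rightarrow> real"
  where "dist_lip0 f g = norm (f - g)"

definition sgn_lip0 :: "'a lip0 \<Rightarrow> 'a lip0"
  where "sgn_lip0 f = f /\<^sub>R norm f"

definition uniformity_lip0 :: "('a lip0 \<times> 'a lip0) filter"
  where "uniformity_lip0 = (INF e\<in>{0<..}. principal {(f, g). dist f g < e})"

definition open_lip0 :: "'a lip0 set \<Rightarrow> bool"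
  where "open_lip0 U = (\<forall>f\<in>U. eventually (\<lambda>(f', g). f' = f \<longrightarrow> g \<in> U) uniformity)"

lemma norm_lip0_le:
  assumes "L-lipschitz_on UNIV (lip0_apply f)"
  shows "norm f \<le> L"
  unfolding norm_lip0_def
  by (rule cInf_lower) (use assms in \<open>auto intro!: bdd_belowI[of _ 0] lipschitz_on_nonneg\<close>)

lemma norm_lip0_lipschitz: "(norm f)-lipschitz_on UNIV (lip0_apply f)"
proof (rule lipschitz_onI)
  let ?S = "{L. L-lipschitz_on UNIV (lip0_apply f)}"
  have ne: "?S \<noteq> {}"
    using lip0_lipschitz_ex by auto
  show "0 \<le> norm f"
    unfolding norm_lip0_def using ne by (rule cInf_greatest) (auto intro: lipschitz_on_nonneg)
  fix x y :: 'a
  show "dist (lip0_apply f x) (lip0_apply f y) \<le> norm f * dist x y"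
  proof (cases "x = y")
    case False
    have "dist (lip0_apply f x) (lip0_apply f y) / dist x y \<le> norm f"
      unfolding norm_lip0_def using ne
      by (rule cInf_greatest)
        (use False in \<open>auto dest: lipschitz_onD[of _ _ _ x y] simp: divide_le_eq\<close>)
    with False show ?thesis
      by (simp add: divide_le_eq)
  qed simp
qed

instance
proof
  fix f g :: "'a lip0" and c :: real
  note lip = norm_lip0_lipschitz
  show "norm f = 0 \<longleftrightarrow> f = 0"
  proof
    assume "norm f = 0"
    then have "lip0_apply f x = 0" for x
      using lipschitz_onD[OF lip[of f], of x base_point] by simp
    then show "f = 0"
      by (intro lip0_eqI) (simp add: zero_lip0.rep_eq)
  next
    assume "f = 0"
    then have "norm f \<le> 0"
      by (intro norm_lip0_le) (simp add: zero_lip0.rep_eq lipschitz_on_def)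
    with lipschitz_on_nonneg[OF lip[of f]] show "norm f = 0"
      by simp
  qed
  show "norm (f + g) \<le> norm f + norm g"
    by (rule norm_lip0_le) (simp add: plus_lip0.rep_eq lipschitz_on_add lip)
  have le: "norm (c *\<^sub>R f) \<le> \<bar>c\<bar> * norm f" for c and f :: "'a lip0"
    by (rule norm_lip0_le) (simp add: scaleR_lip0.rep_eq lipschitz_on_cmult_real lip)
  show "norm (c *\<^sub>R f) = \<bar>c\<bar> * norm f"
  proof (cases "c = 0")
    case True
    with le[of 0 f] lipschitz_on_nonneg[OF lip[of "c *\<^sub>R f"]] show ?thesis
      by simp
  next
    case False
    then have "norm f \<le> \<bar>inverse c\<bar> * norm (c *\<^sub>R f)"
      using le[of "inverse c" "c *\<^sub>R f"] by simp
    with False have "\<bar>c\<bar> * norm f \<le> norm (c *\<^sub>R f)"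
      by (simp add: field_simps)
    with le[of c f] show ?thesis
      by simp
  qed
qed (fact dist_lip0_def sgn_lip0_def uniformity_lip0_def open_lip0_def)+

end

lemma abs_lip0_apply_le: "\<bar>lip0_apply f x\<bar> \<le> norm f * dist x base_point"
  using lipschitz_onD[OF norm_lip0_lipschitz[of f], of x base_point] by simp

lift_definition lip_delta :: "'a::pointed_metric_space \<Rightarrow> 'a lip0 \<Rightarrow>\<^sub>L real"
  is "\<lambda>x f. lip0_apply f x"
proof (rule bounded_linear_intro)
  fix x :: 'a and f g :: "'a lip0" and c :: real
  show "lip0_apply (f + g) x = lip0_apply f x + lip0_apply g x"
    by (simp add: plus_lip0.rep_eq)
  show "lip0_apply (c *\<^sub>R f) x = c *\<^sub>R lip0_apply f x"
    by (simp add: scaleR_lip0.rep_eq)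
  show "norm (lip0_apply f x) \<le> norm f * dist x base_point"
    using abs_lip0_apply_le by simp
qed

(* F(N) for N \<subseteq> M, as a closed subspace of the dual of Lip_0(M); N need not contain
   the base point, since lip_delta vanishes there. *)
definition lip_free :: "'a::pointed_metric_space set \<Rightarrow> ('a lip0 \<Rightarrow>\<^sub>L real) set"
  where "lip_free N = closure (span (lip_delta ` N))"

(* The bounded linear functionals on a linear subspace X, viewed as a normed space in its own
   right; the values of \<phi> outside X are irrelevant. *)
definition bounded_functional_on :: "'b::real_normed_vector set \<Rightarrow> ('b \<Rightarrow> real) \<Rightarrow> bool"
  where "bounded_functional_on X \<phi> \<longleftrightarrow>
    (\<forall>u\<in>X. \<forall>v\<in>X. \<phi> (u + v) = \<phi> u + \<phi> v) \<and>
    (\<forall>c. \<forall>u\<in>X. \<phi> (c *\<^sub>R u) = c * \<phi> u) \<and>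
    (\<exists>C. \<forall>u\<in>X. \<bar>\<phi> u\<bar> \<le> C * norm u)"

definition weakly_null_in :: "'b::real_normed_vector set \<Rightarrow> (nat \<Rightarrow> 'b) \<Rightarrow> bool"
  where "weakly_null_in X u \<longleftrightarrow>
    range u \<subseteq> X \<and> (\<forall>\<phi>. bounded_functional_on X \<phi> \<longrightarrow> (\<lambda>n. \<phi> (u n)) \<longlonglongrightarrow> 0)"

definition schur_property :: "'b::real_normed_vector set \<Rightarrow> bool"
  where "schur_property X \<longleftrightarrow> (\<forall>u. weakly_null_in X u \<longrightarrow> u \<longlonglongrightarrow> 0)"

end

theory Submission
  imports Defs "HOL-Real_Asymp.Real_Asymp"
begin

text \<open>
  Functionals on \<open>\<F>(M)\<close> are evaluations at Lipschitz functions. Let \<open>u\<close> be weakly null in \<open>\<F>(M)\<close>.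
  A gliding hump argument shows that, up to a small error, all \<open>u n\<close> lie in \<open>\<F>(N)\<close> for one small
  neighbourhood \<open>N\<close> of a finite set. Multiplication by a Lipschitz cutoff is a bounded operator that
  moves \<open>u\<close> into such an \<open>\<F>(N)\<close> and changes it very little, because the error can be chosen
  after the norm of the operator. Iterating with ever smaller neighbourhoods yields in the limit
  a sequence \<open>w\<close> uniformly close to \<open>u\<close>, again weakly null, and supported on the intersection of the
  neighbourhoods, which is compact. The Schur property of \<open>\<F>(K)\<close> then makes \<open>w\<close> tend to zero in norm.
\<close>

subsection \<open>Hahn--Banach via minimal sublinear functionals\<close>

text \<open>Two forms of Hahn-Banach are needed. Extension shows that weak nullness in F(N) is
  convergence to zero on every Lipschitz function; separation provides a function that vanishes on N
  and attains the distance to F(N). The cutoff step works because multiplication by a cutoff of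
  width parameter \<delta> has norm at most \<open>1 + 2 / \<delta>\<close>, whatever set containing
  the base point it is built around. Tightness supplies its finite set last, so it may be asked for
  an error that is small relative to this norm. Multiplication acts on F(M) by precomposition and
  therefore preserves weak nullness. The obstacle in the limit is that membership in F(A) for each
  of the decreasing sets A does not visibly give membership in F of their intersection K. Total
  boundedness and completeness show that these sets enter every metric neighbourhood of K, and a
  truncation argument closes the gap.\<close>

definition sublinear :: "('v::real_vector \<Rightarrow> real) \<Rightarrow> bool"
  where "sublinear p \<longleftrightarrow> (\<forall>x y. p (x + y) \<le> p x + p y) \<and> (\<forall>t\<ge>0. \<forall>x. p (t *\<^sub>R x) = t * p x)"

lemma sublinear_add: "sublinear p \<Longrightarrow> p (x + y) \<le> p x + p y"
  and sublinear_scaleR: "sublinear p \<Longrightarrow> 0 \<le> t \<Longrightarrow> p (t *\<^sub>R x) = t * p x"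
  by (simp_all add: sublinear_def)

lemma sublinear_zero: "sublinear p \<Longrightarrow> p 0 = 0"
  using sublinear_scaleR[of p 0 0] by simp

lemma sublinear_minus_le: "sublinear p \<Longrightarrow> - p (- x) \<le> p x"
  using sublinear_add[of p x "- x"] sublinear_zero[of p] by simp

lemma sublinearI:
  assumes add: "\<And>x y. p (x + y) \<le> p x + p y"
    and scale: "\<And>t x. 0 < t \<Longrightarrow> p (t *\<^sub>R x) \<le> t * p x"
    and zero: "p 0 = 0"
  shows "sublinear p"
  unfolding sublinear_def
proof (intro conjI allI impI add)
  fix t :: real and x
  assume "0 \<le> t"
  show "p (t *\<^sub>R x) = t * p x"
  proof (cases "t = 0")
    case False
    with \<open>0 \<le> t\<close> have t: "0 < t" by simp
    have "p x \<le> inverse t * p (t *\<^sub>R x)"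
      using scale[of "inverse t" "t *\<^sub>R x"] t by simp
    with t have "t * p x \<le> p (t *\<^sub>R x)"
      by (simp add: field_simps)
    with scale[OF t, of x] show ?thesis by simp
  qed (simp add: zero)
qed

text \<open>The function \<open>q\<close> is the infimal convolution of \<open>p\<close> with a cone
  \<open>S\<close> of prescribed upper bounds; \<open>S_ge\<close> keeps the infimum finite. A ray
  and the graph of a functional are the two cones used.\<close>

lemma sublinear_Inf_cone:
  fixes p :: "'v::real_vector \<Rightarrow> real" and S :: "('v \<times> real) set"
  assumes p: "sublinear p"
    and S0: "0 \<in> S"
    and S_add: "\<And>a b. a \<in> S \<Longrightarrow> b \<in> S \<Longrightarrow> a + b \<in> S"
    and S_scale: "\<And>t a. 0 < t \<Longrightarrow> a \<in> S \<Longrightarrow> t *\<^sub>R a \<in> S"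
    and S_ge: "\<And>u c. (u, c) \<in> S \<Longrightarrow> - p (- u) \<le> c"
  obtains q where "sublinear q" "\<And>v. q v \<le> p v" "\<And>u c. (u, c) \<in> S \<Longrightarrow> q u \<le> c"
proof
  define q where "q v = Inf ((\<lambda>(u, c). p (v - u) + c) ` S)" for v
  have lower: "- p (- v) \<le> p (v - u) + c" if "(u, c) \<in> S" for u c v
    using S_ge[OF that] sublinear_add[OF p, of "v - u" "- v"] by simp
  have bdd: "bdd_below ((\<lambda>(u, c). p (v - u) + c) ` S)" for v
    using lower by (intro bdd_belowI2[of _ "- p (- v)"]) auto
  have q_le: "q v \<le> p (v - u) + c" if "(u, c) \<in> S" for u c v
    unfolding q_def using that by (intro cInf_lower[OF _ bdd]) force
  have q_ge: "b \<le> q v" if "\<And>u c. (u, c) \<in> S \<Longrightarrow> b \<le> p (v - u) + c" for b v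
    unfolding q_def using S0 that by (intro cInf_greatest) auto
  have zero: "(0, 0) \<in> S"
    using S0 by (simp add: zero_prod_def)
  show "q v \<le> p v" for v
    using q_le[OF zero] by simp
  show "q u \<le> c" if "(u, c) \<in> S" for u c
    using q_le[OF that, of u] sublinear_zero[OF p] by simp
  show "sublinear q"
  proof (rule sublinearI)
    fix x y
    have "q (x + y) - (p (y - u) + c) \<le> q x" if u: "(u, c) \<in> S" for u c
    proof (rule q_ge)
      fix u' c' assume u': "(u', c') \<in> S"
      have "q (x + y) \<le> p ((x + y) - (u' + u)) + (c' + c)"
        using S_add[OF u' u] by (intro q_le) simp
      also have "(x + y) - (u' + u) = (x - u') + (y - u)"
        by simp
      finally show "q (x + y) - (p (y - u) + c) \<le> p (x - u') + c'"
        using sublinear_add[OF p, of "x - u'" "y - u"] by linarith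
    qed
    then have "q (x + y) - q x \<le> q y"
      by (intro q_ge) (simp add: algebra_simps)
    then show "q (x + y) \<le> q x + q y"
      by simp
  next
    fix t :: real and x
    assume t: "0 < t"
    have "inverse t * q (t *\<^sub>R x) \<le> q x"
    proof (rule q_ge)
      fix u c assume u: "(u, c) \<in> S"
      have "q (t *\<^sub>R x) \<le> p (t *\<^sub>R x - t *\<^sub>R u) + t * c"
        using S_scale[OF t u] by (intro q_le) simp
      also have "\<dots> = t * (p (x - u) + c)"
        using sublinear_scaleR[OF p, of t "x - u"] t by (simp add: algebra_simps)
      finally show "inverse t * q (t *\<^sub>R x) \<le> p (x - u) + c"
        using t by (simp add: field_simps)
    qed
    with t show "q (t *\<^sub>R x) \<le> t * q x"
      by (simp add: field_simps)
  next
    have "0 \<le> q 0"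
      using lower[of _ _ 0] sublinear_zero[OF p] by (intro q_ge) simp
    with q_le[OF zero, of 0] sublinear_zero[OF p] show "q 0 = 0"
      by simp
  qed
qed

text \<open>Prescribing \<open>- p w\<close> at \<open>- w\<close> is consistent by positive
  homogeneity. Any linear functional below the resulting \<open>q\<close> takes the value
  \<open>p w\<close> at \<open>w\<close>.\<close>

lemma sublinear_Inf_ray:
  assumes p: "sublinear p"
  obtains q where "sublinear q" "\<And>v. q v \<le> p v" "q (- w) \<le> - p w"
proof -
  let ?S = "(\<lambda>t. (- t *\<^sub>R w, - t * p w)) ` {0..}"
  obtain q where q: "sublinear q" "\<And>v. q v \<le> p v" "\<And>u c. (u, c) \<in> ?S \<Longrightarrow> q u \<le> c"
  proof (rule sublinear_Inf_cone[OF p, of ?S])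
    show "0 \<in> ?S"
      by (rule image_eqI[of _ _ 0]) (simp_all add: zero_prod_def)
    show "a + b \<in> ?S" if "a \<in> ?S" "b \<in> ?S" for a b
    proof -
      from that obtain s t where "0 \<le> s" "a = (- s *\<^sub>R w, - s * p w)"
        "0 \<le> t" "b = (- t *\<^sub>R w, - t * p w)"
        by auto
      then show ?thesis
        by (intro image_eqI[of _ _ "s + t"]) (simp_all add: algebra_simps)
    qed
    show "s *\<^sub>R a \<in> ?S" if "0 < s" "a \<in> ?S" for s a
    proof -
      from that obtain t where "0 \<le> t" "a = (- t *\<^sub>R w, - t * p w)"
        by auto
      with \<open>0 < s\<close> show ?thesis
        by (intro image_eqI[of _ _ "s * t"]) simp_all
    qed
    show "- p (- u) \<le> c" if "(u, c) \<in> ?S" for u c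
      using that sublinear_scaleR[OF p] by auto
  qed blast
  have "(- w, - p w) \<in> ?S"
    by (rule image_eqI[of _ _ 1]) simp_all
  from q(3)[OF this] q(1,2) show thesis
    by (intro that)
qed

text \<open>By minimality the ray construction cannot go strictly below \<open>q\<close>, which
  forces \<open>q (- y) = - q y\<close>. Oddness turns subadditivity into additivity.\<close>

lemma minimal_sublinear_linear:
  assumes q: "sublinear q"
    and minimal: "\<And>r. sublinear r \<Longrightarrow> (\<And>v. r v \<le> q v) \<Longrightarrow> r = q"
  shows "linear q"
proof -
  have neg: "q (- y) = - q y" for y
  proof -
    obtain r where "sublinear r" "\<And>v. r v \<le> q v" "r (- y) \<le> - q y"
      by (rule sublinear_Inf_ray[OF q, of y]) blast
    with minimal sublinear_minus_le[OF q, of y] show ?thesis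
      by (metis antisym minus_le_iff)
  qed
  show ?thesis
  proof (rule linearI)
    fix x y
    have "q x \<le> q (x + y) + q (- y)"
      using sublinear_add[OF q, of "x + y" "- y"] by simp
    with neg[of y] sublinear_add[OF q, of x y] show "q (x + y) = q x + q y"
      by simp
  next
    fix c :: real and x
    show "q (c *\<^sub>R x) = c *\<^sub>R q x"
    proof (cases "0 \<le> c")
      case False
      then show ?thesis
        using sublinear_scaleR[OF q, of "- c" x] neg[of "c *\<^sub>R x"] by simp
    qed (simp add: sublinear_scaleR[OF q])
  qed
qed

lemma ex_linear_le_sublinear:
  assumes p: "sublinear p"
  obtains F where "linear F" "\<And>v. F v \<le> p v"
proof -
  let ?A = "{q. sublinear q \<and> q \<le> p}"
  \<comment> \<open>The order is reversed: maximal for \<open>?R\<close> means minimal as a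
    function.\<close>
  let ?R = "\<lambda>q r. (r :: _ \<Rightarrow> real) \<le> q"
  have "\<exists>m\<in>?A. \<forall>q\<in>?A. ?R m q \<longrightarrow> q = m"
  proof (rule predicate_Zorn)
    show "partial_order_on ?A (relation_of ?R ?A)"
      by (rule partial_order_on_relation_ofI) auto
    fix C assume C: "C \<in> Chains (relation_of ?R ?A)"
    then have CA: "C \<subseteq> ?A" and total: "\<And>q r. q \<in> C \<Longrightarrow> r \<in> C \<Longrightarrow> q \<le> r \<or> r \<le> q"
      by (auto simp: Chains_def relation_of_def)
    show "\<exists>u\<in>?A. \<forall>q\<in>C. u \<le> q"
    proof (cases "C = {}")
      case True
      with p show ?thesis by auto
    next
      case False
      define u where "u v = Inf ((\<lambda>q. q v) ` C)" for v
      have sub: "sublinear q" if "q \<in> C" for q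
        using that CA by auto
      have lower: "- p (- v) \<le> q v" if "q \<in> C" for q v
      proof -
        have "q (- v) \<le> p (- v)"
          using that CA by (auto simp: le_fun_def)
        with sublinear_minus_le[OF sub[OF that], of v] show ?thesis by simp
      qed
      have bdd: "bdd_below ((\<lambda>q. q v) ` C)" for v
        using lower by (intro bdd_belowI2[of _ "- p (- v)"])
      have u_le: "u v \<le> q v" if "q \<in> C" for q v
        unfolding u_def using that by (intro cInf_lower[OF _ bdd]) auto
      have u_ge: "b \<le> u v" if "\<And>q. q \<in> C \<Longrightarrow> b \<le> q v" for b v
        unfolding u_def using False that by (intro cInf_greatest) auto
      have "sublinear u"
      proof (rule sublinearI)
        fix x y
        \<comment> \<open>The chain condition enters here: estimating \<open>u (x + y)\<close> by
          the smaller of \<open>q\<close> and \<open>r\<close> lets the two infima be taken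
          independently.\<close>
        have "u (x + y) - q y \<le> u x" if q: "q \<in> C" for q
        proof (rule u_ge)
          fix r assume r: "r \<in> C"
          show "u (x + y) - q y \<le> r x"
            using total[OF q r]
          proof
            assume "q \<le> r"
            then show ?thesis
              using u_le[OF q, of "x + y"] sublinear_add[OF sub[OF q], of x y] le_funD[of q r x]
              by linarith
          next
            assume "r \<le> q"
            then show ?thesis
              using u_le[OF r, of "x + y"] sublinear_add[OF sub[OF r], of x y] le_funD[of r q y]
              by linarith
          qed
        qed
        then have "u (x + y) - u x \<le> u y"
          by (intro u_ge) (simp add: algebra_simps)
        then show "u (x + y) \<le> u x + u y"
          by simp
      next
        fix t :: real and x
        assume t: "0 < t"
        have "inverse t * u (t *\<^sub>R x) \<le> u x"
        proof (rule u_ge)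
          fix q assume q: "q \<in> C"
          show "inverse t * u (t *\<^sub>R x) \<le> q x"
            using u_le[OF q, of "t *\<^sub>R x"] sublinear_scaleR[OF sub[OF q], of t x] t
            by (simp add: field_simps)
        qed
        with t show "u (t *\<^sub>R x) \<le> t * u x"
          by (simp add: field_simps)
      next
        from False obtain q where "q \<in> C" by auto
        then show "u 0 = 0"
          using sublinear_zero[OF sub] u_le[of q 0] u_ge[of 0 0] by fastforce
      qed
      moreover have "u \<le> p"
      proof -
        from False obtain q where "q \<in> C" by auto
        with u_le[OF this] CA show ?thesis
          by (auto simp: le_fun_def intro: order_trans)
      qed
      ultimately show ?thesis
        using u_le by (auto simp: le_fun_def)
    qed
  qed
  then obtain m where m: "sublinear m" "m \<le> p"
    and minimal: "\<And>q. sublinear q \<Longrightarrow> q \<le> p \<Longrightarrow> q \<le> m \<Longrightarrow> q = m"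
    by auto
  have "linear m"
  proof (rule minimal_sublinear_linear[OF m(1)])
    fix r assume "sublinear r" "\<And>v. r v \<le> m v"
    with m(2) show "r = m"
      by (intro minimal) (auto simp: le_fun_def intro: order_trans)
  qed
  with m(2) that show thesis
    by (auto simp: le_fun_def)
qed

lemma ex_linear_eq_at:
  assumes p: "sublinear p"
  obtains F where "linear F" "\<And>v. F v \<le> p v" "F w = p w"
proof -
  obtain q where q: "sublinear q" "\<And>v. q v \<le> p v" "q (- w) \<le> - p w"
    by (rule sublinear_Inf_ray[OF p, of w]) blast
  obtain F where F: "linear F" "\<And>v. F v \<le> q v"
    by (rule ex_linear_le_sublinear[OF q(1)]) blast
  have "p w \<le> F w"
    using F(2)[of "- w"] q(3) linear_neg[OF F(1)] by simp
  with F q(2) show thesis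
    by (intro that[of F]) (auto intro: antisym order_trans)
qed

text \<open>With the graph of \<open>\<phi>\<close> as cone, a linear functional below the infimal
  convolution is at most \<open>\<phi>\<close> on \<open>X\<close>; applied to \<open>u\<close> and
  \<open>- u\<close> this gives equality.\<close>

lemma bounded_functional_on_extends:
  assumes X: "subspace X" and \<phi>: "bounded_functional_on X \<phi>"
  obtains F C where "linear F" "\<And>v. F v \<le> C * norm v" "\<And>u. u \<in> X \<Longrightarrow> F u = \<phi> u"
proof -
  from \<phi> obtain C0 where add: "\<And>u v. u \<in> X \<Longrightarrow> v \<in> X \<Longrightarrow> \<phi> (u + v) = \<phi> u + \<phi> v"
    and scale: "\<And>c u. u \<in> X \<Longrightarrow> \<phi> (c *\<^sub>R u) = c * \<phi> u"
    and bound: "\<And>u. u \<in> X \<Longrightarrow> \<bar>\<phi> u\<bar> \<le> C0 * norm u"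
    unfolding bounded_functional_on_def by blast
  define C where "C = \<bar>C0\<bar>"
  have bound: "\<bar>\<phi> u\<bar> \<le> C * norm u" if "u \<in> X" for u
    using bound[OF that] by (rule order_trans) (simp add: C_def mult_right_mono)
  have p: "sublinear (\<lambda>v. C * norm v)"
    using norm_triangle_ineq
    by (intro sublinearI) (auto simp: C_def intro!: mult_left_mono simp flip: distrib_left)
  let ?S = "(\<lambda>u. (u, \<phi> u)) ` X"
  obtain q where q: "sublinear q" "\<And>v. q v \<le> C * norm v" "\<And>u c. (u, c) \<in> ?S \<Longrightarrow> q u \<le> c"
  proof (rule sublinear_Inf_cone[OF p, of ?S])
    show "0 \<in> ?S"
      using subspace_0[OF X] scale[of 0 0] by (auto simp: zero_prod_def image_iff)
    show "a + b \<in> ?S" if "a \<in> ?S" "b \<in> ?S" for a b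
      using that add subspace_add[OF X] by (auto simp: image_iff)
    show "t *\<^sub>R a \<in> ?S" if "a \<in> ?S" for t a
      using that scale subspace_scale[OF X] by (auto simp: image_iff)
    show "- (C * norm (- u)) \<le> c" if "(u, c) \<in> ?S" for u c
      using that bound[of u] by auto
  qed blast
  obtain F where F: "linear F" "\<And>v. F v \<le> q v"
    by (rule ex_linear_le_sublinear[OF q(1)]) blast
  have le: "F u \<le> \<phi> u" if "u \<in> X" for u
    using F(2)[of u] q(3)[of u "\<phi> u"] that by auto
  have "F u = \<phi> u" if "u \<in> X" for u
    using le[OF that] le[OF subspace_neg[OF X that]] scale[OF that, of "- 1"] linear_neg[OF F(1), of u]
    by simp
  with F q(2) show thesis
    by (intro that[of F C]) (auto intro: order_trans)
qed

text \<open>Serves as dominating functional for separation: a linear functional below the distance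
  to \<open>X\<close> vanishes on \<open>X\<close>, has norm at most 1, and can be made to attain
  the distance at a chosen point.\<close>

lemma sublinear_infdist_subspace:
  fixes X :: "'v::real_normed_vector set"
  assumes X: "subspace X"
  shows "sublinear (\<lambda>v. infdist v X)"
proof (rule sublinearI)
  have ne: "X \<noteq> {}"
    using subspace_0[OF X] by auto
  have approx: "\<exists>a\<in>X. dist x a < infdist x X + e" if "0 < e" for x e
  proof -
    have "(INF a\<in>X. dist x a) < infdist x X + e"
      using that ne by (simp add: infdist_notempty)
    then show ?thesis
      using ne by (subst (asm) cInf_less_iff) (auto intro: bdd_belowI2[of _ 0])
  qed
  fix x y
  show "infdist (x + y) X \<le> infdist x X + infdist y X"
  proof (rule field_le_epsilon)
    fix e :: real assume "0 < e"
    then obtain a b where "a \<in> X" "dist x a < infdist x X + e / 2"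
      "b \<in> X" "dist y b < infdist y X + e / 2"
      using approx[of "e / 2"] by (meson half_gt_zero)
    then show "infdist (x + y) X \<le> infdist x X + infdist y X + e"
      using infdist_le[OF subspace_add[OF X, of a b], of "x + y"] dist_triangle_add[of x y a b]
      by linarith
  qed
  show "infdist (t *\<^sub>R x) X \<le> t * infdist x X" if "0 < t" for t
  proof (rule field_le_epsilon)
    fix e :: real assume "0 < e"
    with that obtain a where a: "a \<in> X" "dist x a < infdist x X + e / t"
      using approx[of "e / t" x] by auto
    have "dist (t *\<^sub>R x) (t *\<^sub>R a) = t * dist x a"
      using that by (simp add: dist_norm flip: scaleR_diff_right)
    then have "infdist (t *\<^sub>R x) X \<le> t * dist x a"
      using infdist_le[OF subspace_scale[OF X a(1), of t], of "t *\<^sub>R x"] by simp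
    also have "\<dots> \<le> t * (infdist x X + e / t)"
      using a(2) that by (intro mult_left_mono) auto
    finally show "infdist (t *\<^sub>R x) X \<le> t * infdist x X + e"
      using that by (simp add: distrib_left)
  qed
qed (use subspace_0[OF X] in simp)

subsection \<open>Functionals on Lipschitz-free spaces\<close>

lemma lip_delta_apply [simp]: "blinfun_apply (lip_delta x) f = lip0_apply f x"
  by (simp add: lip_delta.rep_eq)

lemma lip0_apply_simps [simp]:
  "lip0_apply 0 x = 0"
  "lip0_apply (f + g) x = lip0_apply f x + lip0_apply g x"
  "lip0_apply (f - g) x = lip0_apply f x - lip0_apply g x"
  by (simp_all add: zero_lip0.rep_eq plus_lip0.rep_eq minus_lip0.rep_eq)

lemma lip_delta_base_point [simp]: "lip_delta base_point = 0"
  by (rule blinfun_eqI) simp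

lemma norm_lip_delta_diff_le: "norm (lip_delta x - lip_delta y) \<le> dist x y"
proof (rule norm_blinfun_bound)
  fix f :: "'a lip0"
  show "norm (blinfun_apply (lip_delta x - lip_delta y) f) \<le> dist x y * norm f"
    using lipschitz_onD[OF norm_lip0_lipschitz[of f], of x y]
    by (simp add: blinfun.diff_left dist_real_def mult.commute)
qed simp

lemma obtain_lip0:
  assumes "C-lipschitz_on UNIV F" "F base_point = 0"
  obtains f where "\<And>x. lip0_apply f x = F x" "norm f \<le> C"
proof -
  have "lip0_apply (Lip0 F) = F"
    using assms by (intro Lip0_inverse) auto
  with assms(1) norm_lip0_le[of C "Lip0 F"] show thesis
    by (intro that[of "Lip0 F"]) simp_all
qed

text \<open>An induction principle: a property that defines a closed subspace need only be checked
  on point evaluations.\<close>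

lemma lip_free_minimal:
  assumes "subspace X" "closed X" "\<And>x. x \<in> N \<Longrightarrow> lip_delta x \<in> X"
  shows "lip_free N \<subseteq> X"
  unfolding lip_free_def using assms by (intro closure_minimal span_minimal) auto

lemma subspace_lip_free: "subspace (lip_free N)"
proof -
  let ?S = "span (lip_delta ` N)"
  have "(\<lambda>(\<mu>, \<nu>). \<mu> + \<nu>) ` closure (?S \<times> ?S) \<subseteq> closure ?S"
    by (rule image_closure_subset)
      (auto intro!: continuous_intros closure_subset[THEN subsetD] span_add simp: split_beta)
  moreover have "(\<lambda>\<mu>. c *\<^sub>R \<mu>) ` closure ?S \<subseteq> closure ?S" for c
    by (rule image_closure_subset)
      (auto intro!: continuous_intros closure_subset[THEN subsetD] span_scale)
  ultimately show ?thesis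
    using closure_subset[of ?S] span_zero[of "lip_delta ` N"]
    by (auto simp: lip_free_def subspace_def closure_Times)
qed

lemma closed_lip_free: "closed (lip_free N)"
  by (simp add: lip_free_def)

lemma lip_free_mono: "N \<subseteq> N' \<Longrightarrow> lip_free N \<subseteq> lip_free N'"
  unfolding lip_free_def by (intro closure_mono span_mono image_mono)

lemma span_lip_delta_subset: "span (lip_delta ` N) \<subseteq> lip_free N"
  unfolding lip_free_def by (rule closure_subset)

lemma lip_free_nonempty: "lip_free N \<noteq> {}"
  using subspace_0[OF subspace_lip_free] by auto

lemma lip_delta_in_lip_free: "x \<in> N \<Longrightarrow> lip_delta x \<in> lip_free N"
  using span_lip_delta_subset span_base by blast

text \<open>This substitutes for a notion of support: functions may be cut off or truncated away
  from \<open>N\<close> without changing the value of \<open>\<mu>\<close>.\<close>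

lemma lip_free_cong:
  assumes \<mu>: "\<mu> \<in> lip_free N" and fg: "\<And>x. x \<in> N \<Longrightarrow> lip0_apply f x = lip0_apply g x"
  shows "blinfun_apply \<mu> f = blinfun_apply \<mu> g"
proof -
  have "lip_free N \<subseteq> {\<mu>. blinfun_apply \<mu> f = blinfun_apply \<mu> g}"
    using fg
    by (intro lip_free_minimal)
      (auto simp: subspace_def blinfun.add_left blinfun.scaleR_left
        intro!: closed_Collect_eq continuous_intros)
  with \<mu> show ?thesis by auto
qed

text \<open>Duality: \<open>f x\<close> is the value of \<open>F\<close> at
  \<open>lip_delta x\<close>, which is Lipschitz because \<open>lip_delta\<close> is 1-Lipschitz.
  Agreement on point evaluations extends to their closed span, and only there.\<close>

lemma linear_eq_lip0_evaluation:
  fixes F :: "('a::pointed_metric_space lip0 \<Rightarrow>\<^sub>L real) \<Rightarrow> real"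
  assumes F: "linear F" and bound: "\<And>\<mu>. F \<mu> \<le> C * norm \<mu>" and C: "0 \<le> C"
  obtains f where "norm f \<le> C" "\<And>\<mu>. \<mu> \<in> lip_free UNIV \<Longrightarrow> F \<mu> = blinfun_apply \<mu> f"
proof -
  have abs_F: "\<bar>F \<mu>\<bar> \<le> C * norm \<mu>" for \<mu>
    using bound[of \<mu>] bound[of "- \<mu>"] linear_neg[OF F, of \<mu>] by simp
  have "C-lipschitz_on UNIV (\<lambda>x. F (lip_delta x))"
  proof (rule lipschitz_onI)
    fix x y :: 'a
    have "\<bar>F (lip_delta x) - F (lip_delta y)\<bar> \<le> C * norm (lip_delta x - lip_delta y)"
      using abs_F by (simp flip: linear_diff[OF F])
    also have "\<dots> \<le> C * dist x y"
      by (intro mult_left_mono norm_lip_delta_diff_le C)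
    finally show "dist (F (lip_delta x)) (F (lip_delta y)) \<le> C * dist x y"
      by (simp add: dist_real_def)
  qed (rule C)
  then obtain f where f: "\<And>x. lip0_apply f x = F (lip_delta x)" "norm f \<le> C"
    by (rule obtain_lip0) (use linear_0[OF F] in auto)
  have "bounded_linear F"
    using F abs_F by (intro bounded_linear.intro bounded_linear_axioms.intro)
      (auto intro!: exI[of _ C] simp: mult.commute)
  then have "lip_free UNIV \<subseteq> {\<mu>. F \<mu> = blinfun_apply \<mu> f}"
    using f(1)
    by (intro lip_free_minimal)
      (auto simp: subspace_def blinfun.add_left blinfun.scaleR_left linear_0[OF F]
          linear_add[OF F] linear_scale[OF F]
        intro!: closed_Collect_eq continuous_intros linear_continuous_on)
  with f(2) that show thesis by auto
qed

text \<open>Hahn-Banach below the distance to \<open>lip_free N\<close>, translated by duality into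
  a function on the metric space.\<close>

lemma lip_free_separation:
  assumes w: "w \<in> lip_free UNIV"
  obtains f where "norm f \<le> 1" "\<And>x. x \<in> N \<Longrightarrow> lip0_apply f x = 0"
    "blinfun_apply w f = infdist w (lip_free N)"
proof -
  obtain F where F: "linear F" "\<And>\<mu>. F \<mu> \<le> infdist \<mu> (lip_free N)" "F w = infdist w (lip_free N)"
    by (rule ex_linear_eq_at[OF sublinear_infdist_subspace[OF subspace_lip_free[of N]], of w]) blast
  have "F \<mu> \<le> 1 * norm \<mu>" for \<mu>
    using F(2)[of \<mu>] infdist_le[OF subspace_0[OF subspace_lip_free[of N]], of \<mu>] by simp
  then obtain f where f: "norm f \<le> 1" "\<And>\<mu>. \<mu> \<in> lip_free UNIV \<Longrightarrow> F \<mu> = blinfun_apply \<mu> f"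
    by (rule linear_eq_lip0_evaluation[OF F(1)]) auto
  have "lip0_apply f x = 0" if "x \<in> N" for x
  proof -
    have x: "lip_delta x \<in> lip_free N"
      using that by (rule lip_delta_in_lip_free)
    have "F (lip_delta x) \<le> 0" "F (- lip_delta x) \<le> 0"
      using F(2)[of "lip_delta x"] F(2)[of "- lip_delta x"] x
        subspace_neg[OF subspace_lip_free x] by simp_all
    then have "F (lip_delta x) = 0"
      using linear_neg[OF F(1)] by simp
    with f(2)[OF lip_delta_in_lip_free, of x] show ?thesis by simp
  qed
  with f w F(3) that show thesis by auto
qed

text \<open>A bounded functional on \<open>lip_free N\<close> extends to the whole dual space and
  then becomes evaluation at a Lipschitz function. The test functions do not depend on
  \<open>N\<close>, so weak nullness passes between free subspaces that contain the
  sequence.\<close>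

lemma weakly_null_in_lip_free_iff:
  fixes N :: "'a::pointed_metric_space set"
  shows "weakly_null_in (lip_free N) u \<longleftrightarrow>
    range u \<subseteq> lip_free N \<and> (\<forall>f. (\<lambda>n. blinfun_apply (u n) f) \<longlonglongrightarrow> 0)"
proof (intro iffI conjI allI)
  fix f
  assume u: "weakly_null_in (lip_free N) u"
  have "\<bar>blinfun_apply \<mu> f\<bar> \<le> norm f * norm \<mu>" for \<mu> :: "'a lip0 \<Rightarrow>\<^sub>L real"
    using norm_blinfun[of \<mu> f] by (simp add: mult.commute)
  then have "bounded_functional_on (lip_free N) (\<lambda>\<mu>. blinfun_apply \<mu> f)"
    unfolding bounded_functional_on_def
    by (auto simp: blinfun.add_left blinfun.scaleR_left intro!: exI[of _ "norm f"])
  with u show "(\<lambda>n. blinfun_apply (u n) f) \<longlonglongrightarrow> 0"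
    unfolding weakly_null_in_def by blast
next
  assume u: "range u \<subseteq> lip_free N \<and> (\<forall>f. (\<lambda>n. blinfun_apply (u n) f) \<longlonglongrightarrow> 0)"
  have "(\<lambda>n. \<phi> (u n)) \<longlonglongrightarrow> 0" if \<phi>: "bounded_functional_on (lip_free N) \<phi>" for \<phi>
  proof -
    obtain F C where F: "linear F" "\<And>v. F v \<le> C * norm v" "\<And>v. v \<in> lip_free N \<Longrightarrow> F v = \<phi> v"
      by (rule bounded_functional_on_extends[OF subspace_lip_free \<phi>]) blast
    have "F v \<le> \<bar>C\<bar> * norm v" for v
      using F(2)[of v] by (rule order_trans) (simp add: mult_right_mono)
    then obtain f where f: "\<And>\<mu>. \<mu> \<in> lip_free UNIV \<Longrightarrow> F \<mu> = blinfun_apply \<mu> f"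
      by (rule linear_eq_lip0_evaluation[OF F(1)]) auto
    have "\<phi> (u n) = blinfun_apply (u n) f" for n
    proof -
      have "u n \<in> lip_free N"
        using u by blast
      with F(3)[of "u n"] f[of "u n"] lip_free_mono[of N UNIV] show ?thesis
        by auto
    qed
    with u show ?thesis by simp
  qed
  with u show "weakly_null_in (lip_free N) u"
    by (simp add: weakly_null_in_def)
qed (simp add: weakly_null_in_def)

lemma lip_free_approx:
  assumes "w \<in> lip_free N" "0 < e"
  obtains v where "v \<in> span (lip_delta ` N)" "norm (w - v) < e"
  using assms unfolding lip_free_def
  by (auto simp: closure_approachable dist_norm norm_minus_commute)

lemma lip_free_span_finite_support:
  assumes "v \<in> span (lip_delta ` N)"
  obtains S where "finite S" "S \<subseteq> N" "v \<in> span (lip_delta ` S)"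
proof -
  from assms obtain T r where "finite T" "T \<subseteq> lip_delta ` N" "v = (\<Sum>a\<in>T. r a *\<^sub>R a)"
    by (auto simp: span_explicit)
  moreover from this obtain S where "finite S" "S \<subseteq> N" "T = lip_delta ` S"
    using finite_subset_image[of T lip_delta N] by blast
  moreover have "(\<Sum>a\<in>T. r a *\<^sub>R a) \<in> span T"
    by (intro span_sum span_scale span_base)
  ultimately show thesis
    by (intro that[of S]) simp_all
qed

text \<open>The constant is the sum of the absolute coefficients in a representation of
  \<open>v\<close>. It makes \<open>v\<close> small on uniformly small functions, independently of
  their Lipschitz constants.\<close>

lemma span_lip_delta_bound:
  assumes "v \<in> span (lip_delta ` N)"
  obtains C where "0 \<le> C"
    "\<And>f s. (\<And>x. x \<in> N \<Longrightarrow> \<bar>lip0_apply f x\<bar> \<le> s) \<Longrightarrow> 0 \<le> s \<Longrightarrow> \<bar>blinfun_apply v f\<bar> \<le> C * s"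
proof -
  have "\<exists>C\<ge>0. \<forall>f s. 0 \<le> s \<and> (\<forall>x\<in>N. \<bar>lip0_apply f x\<bar> \<le> s) \<longrightarrow> \<bar>blinfun_apply v f\<bar> \<le> C * s"
    using assms
  proof (induction rule: span_induct_alt)
    case base
    show ?case by (intro exI[of _ 0]) simp
  next
    case (step c w v)
    then obtain x C where x: "x \<in> N" "w = lip_delta x" and C: "0 \<le> C"
      "\<And>f s. 0 \<le> s \<and> (\<forall>x\<in>N. \<bar>lip0_apply f x\<bar> \<le> s) \<longrightarrow> \<bar>blinfun_apply v f\<bar> \<le> C * s"
      by auto
    have "\<bar>blinfun_apply (c *\<^sub>R w + v) f\<bar> \<le> (\<bar>c\<bar> + C) * s"
      if "0 \<le> s" "\<forall>x\<in>N. \<bar>lip0_apply f x\<bar> \<le> s" for f s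
    proof -
      have "\<bar>blinfun_apply (c *\<^sub>R w + v) f\<bar> \<le> \<bar>c\<bar> * \<bar>lip0_apply f x\<bar> + \<bar>blinfun_apply v f\<bar>"
        by (simp add: x blinfun.add_left blinfun.scaleR_left flip: abs_mult)
      also have "\<dots> \<le> \<bar>c\<bar> * s + C * s"
        using that x C(2) by (intro add_mono mult_left_mono) auto
      finally show ?thesis by (simp add: distrib_right)
    qed
    with C(1) show ?case by (intro exI[of _ "\<bar>c\<bar> + C"]) auto
  qed
  with that show thesis by blast
qed

subsection \<open>Cutoff operators\<close>

text \<open>Neighbourhoods whose width grows linearly with the distance to the base point: multiplication
  by the corresponding cutoffs is bounded on Lipschitz functions even when \<open>M\<close> is unbounded.\<close>

definition conic_nbhd :: "real \<Rightarrow> 'a::pointed_metric_space set \<Rightarrow> 'a set"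
  where "conic_nbhd \<delta> S = {x. infdist x S \<le> \<delta> * (1 + dist x base_point)}"

definition cutoff :: "real \<Rightarrow> 'a::pointed_metric_space set \<Rightarrow> 'a \<Rightarrow> real"
  where "cutoff \<delta> S x = max 0 (min 1 (2 - infdist x S / (\<delta> * (1 + dist x base_point))))"

lemma closed_conic_nbhd: "closed (conic_nbhd \<delta> S)"
  unfolding conic_nbhd_def by (intro closed_Collect_le continuous_intros)

lemma conic_nbhd_mono:
  assumes "S \<subseteq> T" "S \<noteq> {}"
  shows "conic_nbhd \<delta> S \<subseteq> conic_nbhd \<delta> T"
  unfolding conic_nbhd_def using order_trans[OF infdist_mono[OF assms]] by blast

lemma subset_conic_nbhd: "0 \<le> \<delta> \<Longrightarrow> S \<subseteq> conic_nbhd \<delta> S"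
  by (auto simp: conic_nbhd_def)

lemma cutoff_eq_1:
  assumes "0 < \<delta>" "x \<in> conic_nbhd \<delta> S"
  shows "cutoff \<delta> S x = 1"
proof -
  have pos: "0 < \<delta> * (1 + dist x base_point)"
    using assms(1) by (intro mult_pos_pos add_pos_nonneg) simp_all
  have "infdist x S / (\<delta> * (1 + dist x base_point)) \<le> 1"
    unfolding divide_le_eq_1_pos[OF pos] using assms(2) by (simp add: conic_nbhd_def)
  then show ?thesis
    unfolding cutoff_def by linarith
qed

lemma cutoff_eq_0:
  assumes "0 < \<delta>" "x \<notin> conic_nbhd (2 * \<delta>) S"
  shows "cutoff \<delta> S x = 0"
proof -
  have pos: "0 < \<delta> * (1 + dist x base_point)"
    using assms(1) by (intro mult_pos_pos add_pos_nonneg) simp_all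
  have "2 \<le> infdist x S / (\<delta> * (1 + dist x base_point))"
    unfolding pos_le_divide_eq[OF pos] using assms(2) by (simp add: conic_nbhd_def mult.assoc)
  then show ?thesis
    unfolding cutoff_def by linarith
qed

lemma abs_cutoff_le_1: "\<bar>cutoff \<delta> S x\<bar> \<le> 1"
  by (simp add: cutoff_def)

text \<open>A Lipschitz function may grow like \<open>dist x base_point\<close>, so the product rule
  needs this weighted estimate. The cutoff flattens at the same rate because its width grows
  linearly, and the two effects cancel.\<close>

lemma dist_base_point_mult_cutoff_diff_le:
  assumes "0 < \<delta>" and S: "base_point \<in> S"
  shows "dist x base_point * \<bar>cutoff \<delta> S x - cutoff \<delta> S y\<bar> \<le> 2 / \<delta> * dist x y"
proof -
  define a b where "a = dist x base_point" and "b = dist y base_point"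
  define s t where "s = infdist x S" and "t = infdist y S"
  have pos: "0 \<le> a" "0 \<le> b" "0 \<le> t"
    by (simp_all add: a_def b_def t_def infdist_nonneg)
  have nz: "1 + a \<noteq> 0" "1 + b \<noteq> 0"
    using pos by linarith+
  have tb: "t \<le> b"
    using infdist_le[OF S] by (simp add: t_def b_def)
  have st: "\<bar>s - t\<bar> \<le> dist x y"
    unfolding s_def t_def by (rule infdist_triangle_abs)
  have ab: "\<bar>b - a\<bar> \<le> dist x y"
    unfolding a_def b_def using abs_dist_diff_le[of y base_point x]
    by (simp add: dist_commute)
  \<comment> \<open>The splitting puts \<open>1 + a\<close> into both denominators, to be absorbed
    by the weight \<open>a\<close>. The factor \<open>t / (1 + b)\<close> is at most 1 since the
    base point lies in \<open>S\<close>.\<close>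
  have "s / (1 + a) - t / (1 + b) = (s - t) / (1 + a) + (t / (1 + b)) * ((b - a) / (1 + a))"
    using nz by (simp add: divide_simps) (simp add: algebra_simps)
  then have "\<bar>s / (1 + a) - t / (1 + b)\<bar>
      \<le> \<bar>s - t\<bar> / (1 + a) + \<bar>t / (1 + b)\<bar> * (\<bar>b - a\<bar> / (1 + a))"
    using pos abs_triangle_ineq[of "(s - t) / (1 + a)" "(t / (1 + b)) * ((b - a) / (1 + a))"]
    by (simp add: abs_mult)
  also have "\<dots> \<le> dist x y / (1 + a) + 1 * (dist x y / (1 + a))"
    using pos st ab tb by (intro add_mono mult_mono divide_right_mono) auto
  finally have "\<bar>s / (1 + a) - t / (1 + b)\<bar> \<le> 2 * dist x y / (1 + a)"
    by simp
  then have "a * \<bar>s / (1 + a) - t / (1 + b)\<bar> \<le> a * (2 * dist x y / (1 + a))"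
    using pos by (intro mult_left_mono) auto
  also have "\<dots> = a / (1 + a) * (2 * dist x y)"
    by simp
  also have "\<dots> \<le> 1 * (2 * dist x y)"
    using pos by (intro mult_right_mono) auto
  finally have *: "a * \<bar>s / (1 + a) - t / (1 + b)\<bar> \<le> 2 * dist x y"
    by simp
  have "\<bar>cutoff \<delta> S x - cutoff \<delta> S y\<bar> \<le> \<bar>s / (\<delta> * (1 + a)) - t / (\<delta> * (1 + b))\<bar>"
    by (simp add: cutoff_def a_def b_def s_def t_def)
  also have "s / (\<delta> * (1 + a)) - t / (\<delta> * (1 + b)) = (s / (1 + a) - t / (1 + b)) / \<delta>"
    by (simp add: diff_divide_distrib mult.commute)
  finally have "\<bar>cutoff \<delta> S x - cutoff \<delta> S y\<bar> \<le> \<bar>s / (1 + a) - t / (1 + b)\<bar> / \<delta>"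
    using \<open>0 < \<delta>\<close> by simp
  then have "a * \<bar>cutoff \<delta> S x - cutoff \<delta> S y\<bar> \<le> a * (\<bar>s / (1 + a) - t / (1 + b)\<bar> / \<delta>)"
    using pos by (intro mult_left_mono)
  also have "\<dots> \<le> 2 * dist x y / \<delta>"
    using * \<open>0 < \<delta>\<close> by (simp add: divide_right_mono)
  finally show ?thesis
    by (simp add: a_def)
qed

text \<open>In the product rule the increment of \<open>f\<close> carries a factor of size at most
  1, and the increment of the cutoff carries \<open>norm f * dist x base_point\<close>. The bound
  depends on \<open>\<delta>\<close> but not on \<open>S\<close>.\<close>

lemma cutoff_operator:
  fixes S :: "'a::pointed_metric_space set"
  assumes \<delta>: "0 < \<delta>" and S: "base_point \<in> S"
  obtains T :: "'a lip0 \<Rightarrow>\<^sub>L 'a lip0" where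
    "\<And>f x. lip0_apply (blinfun_apply T f) x = cutoff \<delta> S x * lip0_apply f x"
    "norm T \<le> 1 + 2 / \<delta>"
proof -
  let ?C = "1 + 2 / \<delta>"
  have C: "0 \<le> ?C"
    using \<delta> by simp
  have "\<exists>g. (\<forall>x. lip0_apply g x = cutoff \<delta> S x * lip0_apply f x) \<and> norm g \<le> ?C * norm f" for f
  proof -
    have "(?C * norm f)-lipschitz_on UNIV (\<lambda>x. cutoff \<delta> S x * lip0_apply f x)"
    proof (rule lipschitz_onI)
      fix x y :: 'a
      let ?h = "cutoff \<delta> S" and ?f = "lip0_apply f"
      have "?h x * ?f x - ?h y * ?f y = ?h y * (?f x - ?f y) + ?f x * (?h x - ?h y)"
        by (simp add: algebra_simps)
      then have "\<bar>?h x * ?f x - ?h y * ?f y\<bar> \<le> \<bar>?h y\<bar> * \<bar>?f x - ?f y\<bar> + \<bar>?f x\<bar> * \<bar>?h x - ?h y\<bar>"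
        using abs_triangle_ineq[of "?h y * (?f x - ?f y)" "?f x * (?h x - ?h y)"]
        by (simp add: abs_mult)
      also have "\<dots> \<le> 1 * (norm f * dist x y) + (norm f * dist x base_point) * \<bar>?h x - ?h y\<bar>"
        using lipschitz_onD[OF norm_lip0_lipschitz[of f], of x y]
        by (intro add_mono mult_mono abs_cutoff_le_1 abs_lip0_apply_le) (auto simp: dist_real_def)
      also have "\<dots> \<le> 1 * (norm f * dist x y) + norm f * (2 / \<delta> * dist x y)"
        unfolding mult.assoc
        by (intro add_left_mono mult_left_mono dist_base_point_mult_cutoff_diff_le \<delta> S) simp
      finally show "dist (?h x * ?f x) (?h y * ?f y) \<le> ?C * norm f * dist x y"
        by (simp add: dist_real_def algebra_simps)
    qed (use C in simp)
    then show ?thesis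
      by (rule obtain_lip0) auto
  qed
  then obtain T where T: "\<And>f x. lip0_apply (T f) x = cutoff \<delta> S x * lip0_apply f x"
    "\<And>f. norm (T f) \<le> ?C * norm f"
    by metis
  have "bounded_linear T"
  proof (rule bounded_linear_intro)
    show "T (f + g) = T f + T g" for f g
      by (rule lip0_eqI) (simp add: T distrib_left)
    show "T (c *\<^sub>R f) = c *\<^sub>R T f" for c f
      by (rule lip0_eqI) (simp add: T scaleR_lip0.rep_eq)
    show "norm (T f) \<le> norm f * ?C" for f
      using T(2)[of f] by (simp only: mult.commute)
  qed
  then have T_eq: "blinfun_apply (Blinfun T) = T"
    by (rule bounded_linear_Blinfun_apply)
  show thesis
    using T C by (intro that[of "Blinfun T"] norm_blinfun_bound) (simp_all add: T_eq)
qed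

text \<open>Precomposition with multiplication by \<open>h\<close> sends \<open>lip_delta x\<close>
  to its multiple by \<open>h x\<close>, so nothing remains where \<open>h\<close> vanishes.\<close>

lemma lip_free_compose_cutoff_operator:
  fixes T :: "'a::pointed_metric_space lip0 \<Rightarrow>\<^sub>L 'a lip0"
  assumes T: "\<And>f x. lip0_apply (blinfun_apply T f) x = h x * lip0_apply f x"
    and \<mu>: "\<mu> \<in> lip_free N"
  shows "\<mu> o\<^sub>L T \<in> lip_free {x \<in> N. h x \<noteq> 0}"
proof -
  let ?X = "lip_free {x \<in> N. h x \<noteq> 0}"
  have lin: "bounded_linear (\<lambda>\<mu> :: 'a lip0 \<Rightarrow>\<^sub>L real. \<mu> o\<^sub>L T)"
    by (rule bounded_bilinear.bounded_linear_left[OF bounded_bilinear_blinfun_compose])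
  have "lip_free N \<subseteq> (\<lambda>\<mu>. \<mu> o\<^sub>L T) -` ?X"
  proof (rule lip_free_minimal)
    show "subspace ((\<lambda>\<mu>. \<mu> o\<^sub>L T) -` ?X)"
      using subspace_lip_free bounded_linear.linear[OF lin] by (rule linear_subspace_vimage[rotated])
    show "closed ((\<lambda>\<mu>. \<mu> o\<^sub>L T) -` ?X)"
      by (intro continuous_closed_vimage closed_lip_free linear_continuous_at lin)
    fix x assume "x \<in> N"
    have "lip_delta x o\<^sub>L T = h x *\<^sub>R lip_delta x"
      by (rule blinfun_eqI) (simp add: T blinfun.scaleR_left)
    moreover have "h x *\<^sub>R lip_delta x \<in> ?X"
    proof (cases "h x = 0")
      case False
      with \<open>x \<in> N\<close> show ?thesis
        by (intro subspace_scale subspace_lip_free lip_delta_in_lip_free) simp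
    qed (simp add: subspace_0[OF subspace_lip_free])
    ultimately show "lip_delta x \<in> (\<lambda>\<mu>. \<mu> o\<^sub>L T) -` ?X"
      by simp
  qed
  with \<mu> show ?thesis by auto
qed

lemma lip_free_compose_cutoff_operator_eq:
  assumes T: "\<And>f x. lip0_apply (blinfun_apply T f) x = h x * lip0_apply f x"
    and \<mu>: "\<mu> \<in> lip_free N" and "\<And>x. x \<in> N \<Longrightarrow> h x = 1"
  shows "\<mu> o\<^sub>L T = \<mu>"
proof (rule blinfun_eqI)
  fix f
  have "blinfun_apply \<mu> (blinfun_apply T f) = blinfun_apply \<mu> f"
    using assms(3) by (intro lip_free_cong[OF \<mu>]) (simp add: T)
  then show "blinfun_apply (\<mu> o\<^sub>L T) f = blinfun_apply \<mu> f"
    by simp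
qed

text \<open>The sum is defined pointwise, with at most one active summand, which avoids any series
  in \<open>lip0\<close>. The last conclusion recovers a finite sum wherever the tail
  vanishes.\<close>

lemma disjoint_supports_sum:
  fixes g :: "nat \<Rightarrow> 'a::pointed_metric_space lip0"
  assumes disjoint: "\<And>i j x. i < j \<Longrightarrow> lip0_apply (g i) x = 0 \<or> lip0_apply (g j) x = 0"
    and norm: "\<And>i. norm (g i) \<le> C"
  obtains P where "norm P \<le> 2 * C"
    "\<And>x k. \<forall>j\<ge>k. lip0_apply (g j) x = 0 \<Longrightarrow> lip0_apply P x = (\<Sum>j<k. lip0_apply (g j) x)"
proof -
  have "\<exists>i. \<forall>j. j \<noteq> i \<longrightarrow> lip0_apply (g j) x = 0" for x
    using disjoint by (metis nat_neq_iff)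
  \<comment> \<open>\<open>a x\<close> is the only index that can be active at \<open>x\<close>. If
    none is, it is arbitrary and \<open>?P x\<close> is still 0.\<close>
  then obtain a where a: "\<And>x j. j \<noteq> a x \<Longrightarrow> lip0_apply (g j) x = 0"
    by metis
  let ?P = "\<lambda>x. lip0_apply (g (a x)) x"
  have C: "0 \<le> C"
    using norm[of 0] norm_ge_zero[of "g 0"] by linarith
  have lip: "\<bar>lip0_apply (g i) x - lip0_apply (g i) y\<bar> \<le> C * dist x y" for i x y
    using lipschitz_onD[OF norm_lip0_lipschitz[of "g i"], of x y]
      mult_right_mono[OF norm[of i], of "dist x y"]
    by (simp add: dist_real_def)
  have "(2 * C)-lipschitz_on UNIV ?P"
  proof (rule lipschitz_onI)
    fix x y
    show "dist (?P x) (?P y) \<le> 2 * C * dist x y"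
    proof (cases "a x = a y")
      case True
      have "0 \<le> C * dist x y"
        using C by simp
      with lip[of "a x" x y] True show ?thesis
        by (simp add: dist_real_def)
    next
      \<comment> \<open>Now \<open>g (a x)\<close> vanishes at \<open>y\<close> and
        \<open>g (a y)\<close> at \<open>x\<close>, so each of the two values is itself an
        increment; this is the origin of the factor 2.\<close>
      case False
      with lip[of "a x" x y] lip[of "a y" x y] a[of "a y" x] a[of "a x" y] show ?thesis
        by (simp add: dist_real_def)
    qed
  qed (use C in simp)
  then obtain P where P: "\<And>x. lip0_apply P x = ?P x" "norm P \<le> 2 * C"
    by (rule obtain_lip0) auto
  have "lip0_apply P x = (\<Sum>j<k. lip0_apply (g j) x)"
    if zero: "\<forall>j\<ge>k. lip0_apply (g j) x = 0" for x k
  proof (cases "a x < k")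
    case True
    have "(\<Sum>j<k. lip0_apply (g j) x) = (\<Sum>j\<in>{a x}. lip0_apply (g j) x)"
      using True a by (intro sum.mono_neutral_right) auto
    then show ?thesis
      by (simp add: P)
  next
    case False
    with zero a show ?thesis
      by (subst sum.neutral) (auto simp: P)
  qed
  with P(2) that show thesis by blast
qed

subsection \<open>Tightness of weakly null sequences\<close>

text \<open>\<open>G\<close> is the sum of the humps so far and \<open>g\<close> the next one. The
  lower bound is claimed for every \<open>P\<close> agreeing with \<open>G + g\<close> on
  \<open>E'\<close>, so it survives the addition of later humps, which vanish there; the bound on
  \<open>norm P\<close> is the one available for the total sum.\<close>

lemma gliding_hump_step:
  fixes u :: "nat \<Rightarrow> 'a::pointed_metric_space lip0 \<Rightarrow>\<^sub>L real"
  assumes u: "range u \<subseteq> lip_free UNIV"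
    and null: "\<And>f. (\<lambda>n. blinfun_apply (u n) f) \<longlonglongrightarrow> 0"
    and pos: "0 < \<delta>" "0 < \<epsilon>"
    and far: "\<forall>E. finite E \<and> base_point \<in> E \<longrightarrow>
      (\<exists>n. \<epsilon> < infdist (u n) (lip_free (conic_nbhd (2 * \<delta>) E)))"
    and E: "finite E" "base_point \<in> E"
  obtains n E' g where "k \<le> n" "finite E'" "E \<subseteq> E'" "norm g \<le> 1 + 2 / \<delta>"
    "\<And>x. x \<in> conic_nbhd (2 * \<delta>) E \<Longrightarrow> lip0_apply g x = 0"
    "\<And>x. x \<notin> conic_nbhd (2 * \<delta>) E' \<Longrightarrow> lip0_apply g x = 0"
    "\<forall>P. norm P \<le> 2 * (1 + 2 / \<delta>) \<and> (\<forall>x\<in>E'. lip0_apply P x = lip0_apply (G + g) x)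
      \<longrightarrow> \<epsilon> / 2 \<le> blinfun_apply (u n) P"
proof -
  let ?C = "1 + 2 / \<delta>"
  have "(\<lambda>n. blinfun_apply (u n) G) \<longlonglongrightarrow> 0"
    by (rule null)
  then have "eventually (\<lambda>n. dist (blinfun_apply (u n) G) 0 < \<epsilon> / 4) sequentially"
    by (rule tendstoD) (use pos in simp)
  then obtain m0 where m0: "\<bar>blinfun_apply (u n) G\<bar> < \<epsilon> / 4" if "m0 \<le> n" for n
    by (auto simp: eventually_sequentially dist_real_def)
  define m where "m = max m0 k"
  have "\<exists>S. finite S \<and> infdist (u i) (lip_free S) \<le> \<epsilon>" for i
  proof -
    have "u i \<in> lip_free UNIV"
      using u by blast
    then obtain v where v: "v \<in> span (range lip_delta)" "norm (u i - v) < \<epsilon>"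
      using pos(2) by (rule lip_free_approx)
    from v(1) obtain S where S: "finite S" "v \<in> span (lip_delta ` S)"
      by (rule lip_free_span_finite_support)
    then have "infdist (u i) (lip_free S) \<le> dist (u i) v"
      using span_lip_delta_subset by (intro infdist_le) blast
    with v(2) S(1) show ?thesis
      by (intro exI[of _ S]) (simp add: dist_norm)
  qed
  then obtain S where S: "\<And>i. finite (S i)" "\<And>i. infdist (u i) (lip_free (S i)) \<le> \<epsilon>"
    by metis
  \<comment> \<open>Absorbing approximate supports of all \<open>u i\<close> with
    \<open>i < m\<close> excludes these indices from \<open>far\<close>, so the index found next is
    at least \<open>m\<close>.\<close>
  define E1 where "E1 = E \<union> (\<Union>i<m. S i)"
  obtain n where n: "\<epsilon> < infdist (u n) (lip_free (conic_nbhd (2 * \<delta>) E1))"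
    using far[rule_format, of E1] E S(1) by (auto simp: E1_def)
  have "m \<le> n"
  proof (rule ccontr)
    assume "\<not> m \<le> n"
    then have "S n \<subseteq> E1"
      by (auto simp: E1_def)
    also have "\<dots> \<subseteq> conic_nbhd (2 * \<delta>) E1"
      using pos by (intro subset_conic_nbhd) simp
    finally have "infdist (u n) (lip_free (conic_nbhd (2 * \<delta>) E1)) \<le> infdist (u n) (lip_free (S n))"
      by (intro infdist_mono lip_free_mono lip_free_nonempty)
    with n S(2)[of n] show False by simp
  qed
  have un: "u n \<in> lip_free UNIV"
    using u by blast
  then obtain f where f: "norm f \<le> 1"
    "\<And>x. x \<in> conic_nbhd (2 * \<delta>) E1 \<Longrightarrow> lip0_apply f x = 0"
    "blinfun_apply (u n) f = infdist (u n) (lip_free (conic_nbhd (2 * \<delta>) E1))"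
    by (rule lip_free_separation[where N = "conic_nbhd (2 * \<delta>) E1"]) blast
  \<comment> \<open>\<open>D\<close> bounds the norms of \<open>P\<close>, \<open>G\<close> and
    \<open>f\<close> together, so replacing \<open>u n\<close> by \<open>v\<close> on all three
    costs at most \<open>\<epsilon> / 4\<close>. Another \<open>\<epsilon> / 4\<close> is lost to
    \<open>G\<close>, leaving \<open>\<epsilon> / 2\<close> of the value at \<open>f\<close>, which
    exceeds \<open>\<epsilon>\<close>.\<close>
  define D where "D = 2 * ?C + norm G + norm f"
  have D: "0 < D"
    using pos by (simp add: D_def add_pos_nonneg)
  obtain v where v: "v \<in> span (range lip_delta)" "norm (u n - v) < \<epsilon> / (4 * D)"
    using lip_free_approx[OF un, of "\<epsilon> / (4 * D)"] pos D by auto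
  from v(1) obtain S' where S': "finite S'" "v \<in> span (lip_delta ` S')"
    by (rule lip_free_span_finite_support)
  \<comment> \<open>A cutoff around \<open>E'\<close> leaves \<open>f\<close> unchanged on
    \<open>S'\<close>, so \<open>v\<close> cannot tell \<open>g\<close> from \<open>f\<close>, while
    \<open>g\<close> lives near a finite set.\<close>
  define E' where "E' = E \<union> S'"
  have bE': "base_point \<in> E'"
    using E by (simp add: E'_def)
  obtain T :: "'a lip0 \<Rightarrow>\<^sub>L 'a lip0" where T: "\<And>f x. lip0_apply (blinfun_apply T f) x = cutoff \<delta> E' x * lip0_apply f x"
    "norm T \<le> ?C"
    using cutoff_operator[OF pos(1) bE'] by blast
  define g where "g = blinfun_apply T f"
  have approx: "\<bar>blinfun_apply (u n) h - blinfun_apply v h\<bar> \<le> \<epsilon> / (4 * D) * norm h" for h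
  proof -
    have "\<bar>blinfun_apply (u n) h - blinfun_apply v h\<bar> \<le> norm (u n - v) * norm h"
      using norm_blinfun[of "u n - v" h] by (simp add: blinfun.diff_left)
    also have "\<dots> \<le> \<epsilon> / (4 * D) * norm h"
      using v(2) by (intro mult_right_mono) auto
    finally show ?thesis .
  qed
  have vE': "v \<in> lip_free E'"
    using S'(2) span_lip_delta_subset lip_free_mono[of S' E'] by (auto simp: E'_def)
  have gE': "lip0_apply g x = lip0_apply f x" if "x \<in> E'" for x
    using cutoff_eq_1[OF pos(1), of x E'] subset_conic_nbhd[of \<delta> E'] that pos
    by (auto simp: g_def T)
  show thesis
  proof (rule that)
    show "k \<le> n"
      using \<open>m \<le> n\<close> by (simp add: m_def)
    show "finite E'" "E \<subseteq> E'"
      using E S' by (auto simp: E'_def)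
    have "norm g \<le> norm T * norm f"
      unfolding g_def by (rule norm_blinfun)
    also have "\<dots> \<le> ?C * 1"
      using T(2) f(1) pos by (intro mult_mono) auto
    finally show "norm g \<le> ?C" by simp
    show "lip0_apply g x = 0" if "x \<in> conic_nbhd (2 * \<delta>) E" for x
    proof -
      have "x \<in> conic_nbhd (2 * \<delta>) E1"
        using that E conic_nbhd_mono[of E E1] by (auto simp: E1_def)
      then show ?thesis
        by (simp add: g_def T f(2))
    qed
    show "lip0_apply g x = 0" if "x \<notin> conic_nbhd (2 * \<delta>) E'" for x
      using cutoff_eq_0[OF pos(1) that] by (simp add: g_def T)
    show "\<forall>P. norm P \<le> 2 * ?C \<and> (\<forall>x\<in>E'. lip0_apply P x = lip0_apply (G + g) x)
      \<longrightarrow> \<epsilon> / 2 \<le> blinfun_apply (u n) P"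
    proof (intro allI impI, elim conjE)
      fix P assume P: "norm P \<le> 2 * ?C" "\<forall>x\<in>E'. lip0_apply P x = lip0_apply (G + g) x"
      have "blinfun_apply v P = blinfun_apply v (G + f)"
        using P(2) gE' by (intro lip_free_cong[OF vE']) simp
      then have "blinfun_apply (u n) P \<ge> blinfun_apply (u n) G + blinfun_apply (u n) f
          - \<epsilon> / (4 * D) * norm P - \<epsilon> / (4 * D) * norm G - \<epsilon> / (4 * D) * norm f"
        using approx[of P] approx[of G] approx[of f] by (simp add: blinfun.add_right)
      moreover have "\<epsilon> / (4 * D) * norm P + \<epsilon> / (4 * D) * norm G + \<epsilon> / (4 * D) * norm f \<le> \<epsilon> / 4"
      proof -
        have "\<epsilon> / (4 * D) * (norm P + norm G + norm f) \<le> \<epsilon> / (4 * D) * D"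
          using P(1) pos D by (intro mult_left_mono) (auto simp: D_def)
        also have "\<dots> = \<epsilon> / 4"
          using D by simp
        finally show ?thesis
          by (simp only: distrib_left)
      qed
      ultimately show "\<epsilon> / 2 \<le> blinfun_apply (u n) P"
        using m0[of n] \<open>m \<le> n\<close> n f(3) by (simp add: m_def)
    qed
  qed
qed

text \<open>Otherwise a gliding hump yields Lipschitz functions with disjoint supports whose sum does
  not tend to zero along \<open>u\<close>.\<close>

lemma weakly_null_tight:
  fixes u :: "nat \<Rightarrow> 'a::pointed_metric_space lip0 \<Rightarrow>\<^sub>L real"
  assumes u: "range u \<subseteq> lip_free UNIV"
    and null: "\<And>f. (\<lambda>n. blinfun_apply (u n) f) \<longlonglongrightarrow> 0"
    and pos: "0 < \<delta>" "0 < \<epsilon>"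
  shows "\<exists>E. finite E \<and> base_point \<in> E \<and>
    (\<forall>n. infdist (u n) (lip_free (conic_nbhd (2 * \<delta>) E)) \<le> \<epsilon>)"
proof (rule ccontr)
  assume "\<not> ?thesis"
  then have far: "\<forall>E. finite E \<and> base_point \<in> E \<longrightarrow>
      (\<exists>n. \<epsilon> < infdist (u n) (lip_free (conic_nbhd (2 * \<delta>) E)))"
    by (auto simp: not_le)
  let ?C = "1 + 2 / \<delta>"
  let ?N = "conic_nbhd (2 * \<delta>) :: 'a set \<Rightarrow> 'a set"
  let ?R = "\<lambda>k (E, G) (E', G'). E \<subseteq> E' \<and> norm (G' - G) \<le> ?C \<and>
    (\<forall>x\<in>?N E. lip0_apply (G' - G) x = 0) \<and> (\<forall>x. x \<notin> ?N E' \<longrightarrow> lip0_apply (G' - G) x = 0) \<and>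
    (\<exists>n\<ge>k. \<forall>P. norm P \<le> 2 * ?C \<and> (\<forall>x\<in>E'. lip0_apply P x = lip0_apply G' x)
      \<longrightarrow> \<epsilon> / 2 \<le> blinfun_apply (u n) P)"
  \<comment> \<open>Starting from \<open>G = 0\<close> makes the partial sums of the humps telescope
    to exactly \<open>G k\<close>.\<close>
  let ?I = "\<lambda>k (E, G :: 'a lip0). finite E \<and> base_point \<in> E \<and> (k = (0::nat) \<longrightarrow> G = 0)"
  have "\<exists>s. \<forall>k. ?I k (s k) \<and> ?R k (s k) (s (Suc k))"
  proof (rule dependent_nat_choice)
    show "\<exists>s. ?I 0 s"
      by (intro exI[of _ "({base_point}, 0)"]) simp
    fix s :: "'a set \<times> 'a lip0" and k
    assume "?I k s"
    then obtain E G where s: "s = (E, G)" and E: "finite E" "base_point \<in> E"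
      by (cases s) auto
    obtain n E' g where n: "k \<le> n" "finite E'" "E \<subseteq> E'" "norm g \<le> ?C"
      "\<And>x. x \<in> ?N E \<Longrightarrow> lip0_apply g x = 0"
      "\<And>x. x \<notin> ?N E' \<Longrightarrow> lip0_apply g x = 0"
      "\<forall>P. norm P \<le> 2 * ?C \<and> (\<forall>x\<in>E'. lip0_apply P x = lip0_apply (G + g) x)
        \<longrightarrow> \<epsilon> / 2 \<le> blinfun_apply (u n) P"
      by (rule gliding_hump_step[OF u null pos far E, of k G]) (rule that)
    have zero: "\<forall>x\<in>?N E. lip0_apply g x = 0"
      using n(5) by (rule ballI)
    have supp: "\<forall>x. x \<notin> ?N E' \<longrightarrow> lip0_apply g x = 0"
      using n(6) by (intro allI impI)
    have ex: "\<exists>n\<ge>k. \<forall>P. norm P \<le> 2 * ?C \<and> (\<forall>x\<in>E'. lip0_apply P x = lip0_apply (G + g) x)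
        \<longrightarrow> \<epsilon> / 2 \<le> blinfun_apply (u n) P"
      by (rule exI, rule conjI[OF n(1,7)])
    have diff: "G + g - G = g"
      by simp
    have "?R k s (E', G + g)"
      unfolding s prod.case diff by (intro conjI n(3,4) zero supp ex)
    moreover have "?I (Suc k) (E', G + g)"
      using n(2,3) E(2) by auto
    ultimately have "?I (Suc k) (E', G + g) \<and> ?R k s (E', G + g)"
      by (rule conjI[rotated])
    then show "\<exists>t. ?I (Suc k) t \<and> ?R k s t" ..
  qed
  then obtain s where s: "\<forall>k. ?I k (s k) \<and> ?R k (s k) (s (Suc k))" ..
  define E G where "E k = fst (s k)" and "G k = snd (s k)" for k
  define g where "g k = G (Suc k) - G k" for k
  have s_eq: "s k = (E k, G k)" for k
    by (simp add: E_def G_def)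
  note I = s[THEN spec, THEN conjunct1, unfolded s_eq prod.case]
  note R = s[THEN spec, THEN conjunct2, unfolded s_eq prod.case, folded g_def]
  have bE: "base_point \<in> E k" and G0: "G 0 = 0" for k
    using I[of k] I[of 0] by simp_all
  have E_Suc: "E k \<subseteq> E (Suc k)" and norm_g: "norm (g k) \<le> ?C" for k
    using R[of k, THEN conjunct1] R[of k, THEN conjunct2, THEN conjunct1] by simp_all
  have g_zero: "lip0_apply (g k) x = 0" if "x \<in> ?N (E k)" for k x
    using R[of k, THEN conjunct2, THEN conjunct2, THEN conjunct1] that by blast
  have g_supp: "lip0_apply (g k) x = 0" if "x \<notin> ?N (E (Suc k))" for k x
    using R[of k, THEN conjunct2, THEN conjunct2, THEN conjunct2, THEN conjunct1] that by blast
  note large = R[THEN conjunct2, THEN conjunct2, THEN conjunct2, THEN conjunct2]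
  have E_mono: "E i \<subseteq> E j" if "i \<le> j" for i j
    using that E_Suc by (rule lift_Suc_mono_le[rotated])
  have N_mono: "?N (E i) \<subseteq> ?N (E j)" if "i \<le> j" for i j
    using E_mono[OF that] bE by (intro conic_nbhd_mono) auto
  \<comment> \<open>Hump \<open>i\<close> lives in the neighbourhood of \<open>E (Suc i)\<close>,
    which is contained in that of \<open>E j\<close>, where hump \<open>j\<close> vanishes.\<close>
  have disjoint: "lip0_apply (g i) x = 0 \<or> lip0_apply (g j) x = 0" if "i < j" for i j x
    using N_mono[of "Suc i" j] that g_supp[of x i] g_zero[of x j] by auto
  obtain P where P: "norm P \<le> 2 * ?C"
    "\<And>x k. \<forall>j\<ge>k. lip0_apply (g j) x = 0 \<Longrightarrow> lip0_apply P x = (\<Sum>j<k. lip0_apply (g j) x)"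
  proof (rule disjoint_supports_sum)
    show "lip0_apply (g i) x = 0 \<or> lip0_apply (g j) x = 0" if "i < j" for i j x
      using that by (rule disjoint)
    show "norm (g i) \<le> ?C" for i
      by (rule norm_g)
  qed (rule that)
  have sum_g: "(\<Sum>j<k. lip0_apply (g j) x) = lip0_apply (G k) x" for k x
    by (induction k) (simp_all add: g_def G0)
  \<comment> \<open>Humps from index \<open>k\<close> on vanish on \<open>E k\<close>. The lower
    bound of stage \<open>k\<close> concerns \<open>E (Suc k)\<close>, hence the later use at
    \<open>Suc k\<close>.\<close>
  have P_eq: "lip0_apply P x = lip0_apply (G k) x" if "x \<in> E k" for k x
  proof -
    have "lip0_apply (g j) x = 0" if "k \<le> j" for j
    proof (rule g_zero)
      have "E k \<subseteq> E j"
        using that by (rule E_mono)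
      also have "\<dots> \<subseteq> ?N (E j)"
        using pos by (intro subset_conic_nbhd) simp
      finally show "x \<in> ?N (E j)"
        using \<open>x \<in> E k\<close> by blast
    qed
    with P(2)[of k x] sum_g show ?thesis by simp
  qed
  have "eventually (\<lambda>n. dist (blinfun_apply (u n) P) 0 < \<epsilon> / 2) sequentially"
    using null[of P] by (rule tendstoD) (use pos in simp)
  then obtain k where "\<And>n. k \<le> n \<Longrightarrow> \<bar>blinfun_apply (u n) P\<bar> < \<epsilon> / 2"
    by (auto simp: eventually_sequentially dist_real_def)
  moreover obtain n where "k \<le> n" "\<epsilon> / 2 \<le> blinfun_apply (u n) P"
    using large[of k] P(1) P_eq[of _ "Suc k"] by auto
  ultimately show False
    by fastforce
qed

text \<open>The set \<open>A\<close> records the neighbourhoods already used, so that supports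
  decrease under iteration.\<close>

lemma weakly_null_cutoff:
  fixes u :: "nat \<Rightarrow> 'a::pointed_metric_space lip0 \<Rightarrow>\<^sub>L real"
  assumes u: "range u \<subseteq> lip_free A"
    and null: "\<And>f. (\<lambda>n. blinfun_apply (u n) f) \<longlonglongrightarrow> 0"
    and pos: "0 < \<delta>" "0 < \<epsilon>"
  obtains E u' where "finite E" "base_point \<in> E" "range u' \<subseteq> lip_free (A \<inter> conic_nbhd \<delta> E)"
    "\<And>f. (\<lambda>n. blinfun_apply (u' n) f) \<longlonglongrightarrow> 0" "\<And>n. norm (u' n - u n) \<le> \<epsilon>"
proof -
  let ?C = "1 + 2 / (\<delta> / 2)"
  have C: "0 < ?C + 1"
    using pos by (simp add: add_pos_nonneg)
  \<comment> \<open>The operator and the identity amplify the error by \<open>?C + 1\<close>. The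
    factor 2 is there because a point \<open>v\<close> is only chosen within
    \<open>2 * \<eta>\<close>.\<close>
  define \<eta> where "\<eta> = \<epsilon> / (2 * (?C + 1))"
  have \<eta>: "0 < \<eta>"
    using pos C by (simp add: \<eta>_def)
  have cancel: "c * (2 * (\<epsilon> / (2 * c))) = \<epsilon>" if "0 < c" for c
    using that by simp
  have uU: "range u \<subseteq> lip_free UNIV"
    using u lip_free_mono[of A UNIV] by blast
  \<comment> \<open>Tightness at \<open>\<delta> / 4\<close> refers to
    \<open>conic_nbhd (\<delta> / 2) E\<close>, where \<open>cutoff (\<delta> / 2) E\<close> equals
    1; that cutoff vanishes outside \<open>conic_nbhd \<delta> E\<close>.\<close>
  obtain E where E: "finite E" "base_point \<in> E"
    "\<And>n. infdist (u n) (lip_free (conic_nbhd (2 * (\<delta> / 4)) E)) \<le> \<eta>"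
    using weakly_null_tight[OF uU null _ \<eta>, of "\<delta> / 4"] pos by (meson divide_pos_pos zero_less_numeral)
  obtain T :: "'a lip0 \<Rightarrow>\<^sub>L 'a lip0" where
    T: "\<And>f x. lip0_apply (blinfun_apply T f) x = cutoff (\<delta> / 2) E x * lip0_apply f x"
    "norm T \<le> ?C"
    using cutoff_operator[of "\<delta> / 2" E] E(2) pos by auto
  show thesis
  proof (rule that[OF E(1,2)])
    show "range (\<lambda>n. u n o\<^sub>L T) \<subseteq> lip_free (A \<inter> conic_nbhd \<delta> E)"
    proof safe
      fix n
      have "u n \<in> lip_free A"
        using u by blast
      then have "u n o\<^sub>L T \<in> lip_free {x \<in> A. cutoff (\<delta> / 2) E x \<noteq> 0}"
        by (rule lip_free_compose_cutoff_operator[OF T(1)])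
      also have "\<dots> \<subseteq> lip_free (A \<inter> conic_nbhd \<delta> E)"
        using cutoff_eq_0[of "\<delta> / 2" _ E] pos by (intro lip_free_mono) auto
      finally show "u n o\<^sub>L T \<in> lip_free (A \<inter> conic_nbhd \<delta> E)" .
    qed
    show "(\<lambda>n. blinfun_apply (u n o\<^sub>L T) f) \<longlonglongrightarrow> 0" for f
      using null[of "blinfun_apply T f"] by simp
    fix n
    let ?X = "lip_free (conic_nbhd (\<delta> / 2) E)"
    have "(INF v\<in>?X. dist (u n) v) < 2 * \<eta>"
      using E(3)[of n] \<eta> by (simp add: infdist_notempty lip_free_nonempty)
    then obtain v where v: "v \<in> ?X" "dist (u n) v < 2 * \<eta>"
      by (subst (asm) cInf_less_iff) (auto intro: bdd_belowI2[of _ 0] simp: lip_free_nonempty)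
    have "v o\<^sub>L T = v"
      using v(1) pos cutoff_eq_1[of "\<delta> / 2" _ E]
      by (intro lip_free_compose_cutoff_operator_eq[OF T(1)]) auto
    then have "(u n o\<^sub>L T) - u n = ((u n - v) o\<^sub>L T) - (u n - v)"
      by (simp add: bounded_bilinear.diff_left[OF bounded_bilinear_blinfun_compose])
    then have "norm ((u n o\<^sub>L T) - u n) \<le> norm ((u n - v) o\<^sub>L T) + norm (u n - v)"
      by (metis norm_triangle_ineq4)
    also have "\<dots> \<le> norm (u n - v) * ?C + norm (u n - v)"
      using norm_blinfun_compose[of "u n - v" T] mult_left_mono[OF T(2), of "norm (u n - v)"] by simp
    also have "\<dots> = (?C + 1) * norm (u n - v)"
      by (simp add: algebra_simps)
    also have "\<dots> \<le> (?C + 1) * (2 * \<eta>)"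
      using v(2) C by (intro mult_left_mono) (auto simp: dist_norm)
    also have "\<dots> = \<epsilon>"
      unfolding \<eta>_def by (rule cancel[OF C])
    finally show "norm ((u n o\<^sub>L T) - u n) \<le> \<epsilon>" .
  qed
qed

subsection \<open>Compact reduction\<close>

lemma geometric_Cauchy_limit:
  fixes x :: "nat \<Rightarrow> 'b::banach"
  assumes step: "\<And>k. norm (x (Suc k) - x k) \<le> e * (1 / 2) ^ k"
  obtains l where "\<And>k. norm (l - x k) \<le> 2 * e * (1 / 2) ^ k"
proof -
  have summ: "summable (\<lambda>i. e * (1 / 2 :: real) ^ (i + k))" for k
    by (intro summable_mult summable_ignore_initial_segment summable_geometric) simp
  have diff: "summable (\<lambda>i. x (Suc (i + k)) - x (i + k))" for k
    by (rule summable_comparison_test'[OF summ[of k]]) (rule step)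
  have "norm (x 0 + (\<Sum>i. x (Suc i) - x i) - x k) \<le> 2 * e * (1 / 2) ^ k" for k
  proof -
    have "(\<Sum>i. x (Suc i) - x i) = (\<Sum>i. x (Suc (i + k)) - x (i + k)) + (\<Sum>i<k. x (Suc i) - x i)"
      using diff[of 0] by (intro suminf_split_initial_segment) simp
    also have "(\<Sum>i<k. x (Suc i) - x i) = x k - x 0"
      by (rule sum_lessThan_telescope)
    finally have "x 0 + (\<Sum>i. x (Suc i) - x i) - x k = (\<Sum>i. x (Suc (i + k)) - x (i + k))"
      by simp
    also have "norm \<dots> \<le> (\<Sum>i. e * (1 / 2) ^ (i + k))"
      by (rule norm_suminf_le[OF _ summ]) (rule step)
    also have "\<dots> = 2 * e * (1 / 2) ^ k"
    proof -
      have "(\<lambda>i. (e * (1 / 2) ^ k) * (1 / 2 :: real) ^ i) sums ((e * (1 / 2) ^ k) * (1 / (1 - 1 / 2)))"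
        by (intro sums_mult geometric_sums) simp
      then show ?thesis
        by (simp add: sums_iff power_add mult.commute mult.left_commute)
    qed
    finally show ?thesis .
  qed
  then show thesis
    by (rule that)
qed

text \<open>If \<open>f\<close> vanishes on \<open>K\<close>, it agrees near \<open>K\<close> with a truncation which is uniformly small, and
  elements of \<open>\<F>(M)\<close> are almost zero on uniformly small functions of bounded norm.\<close>

lemma lip_free_limit_of_shrinking_supports:
  fixes K :: "'a::pointed_metric_space set"
  assumes w: "w \<in> lip_free UNIV" and K: "base_point \<in> K"
    and approx: "\<And>\<eta>. 0 < \<eta> \<Longrightarrow>
      \<exists>B \<mu>. \<mu> \<in> lip_free B \<and> norm (w - \<mu>) \<le> \<eta> \<and> (\<forall>x\<in>B. infdist x K \<le> \<eta>)"
  shows "w \<in> lip_free K"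
proof -
  obtain f where f: "norm f \<le> 1" "\<And>x. x \<in> K \<Longrightarrow> lip0_apply f x = 0"
    "blinfun_apply w f = infdist w (lip_free K)"
    using lip_free_separation[OF w, of K] by blast
  have Kne: "K \<noteq> {}"
    using K by auto
  have lip: "\<bar>lip0_apply f x - lip0_apply f y\<bar> \<le> dist x y" for x y
    using lipschitz_onD[OF norm_lip0_lipschitz[of f], of x y] mult_right_mono[OF f(1), of "dist x y"]
    by (simp add: dist_real_def)
  have f_le: "\<bar>lip0_apply f x\<bar> \<le> infdist x K" for x
    unfolding infdist_notempty[OF Kne]
  proof (rule cINF_greatest[OF Kne])
    fix y assume "y \<in> K"
    with lip[of x y] f(2)[of y] show "\<bar>lip0_apply f x\<bar> \<le> dist x y"
      by simp
  qed
  have small: "infdist w (lip_free K) \<le> e" if e: "0 < e" for e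
  proof -
    obtain v where v: "v \<in> span (range lip_delta)" "norm (w - v) < e / 4"
      using lip_free_approx[OF w, of "e / 4"] e by auto
    obtain C where C: "0 \<le> C"
      "\<And>f s. (\<And>x. x \<in> UNIV \<Longrightarrow> \<bar>lip0_apply f x\<bar> \<le> s) \<Longrightarrow> 0 \<le> s \<Longrightarrow> \<bar>blinfun_apply v f\<bar> \<le> C * s"
      using span_lip_delta_bound[OF v(1)] by blast
    \<comment> \<open>Four errors of at most \<open>e / 4\<close>: from \<open>w\<close> to
      \<open>\<mu>\<close> at \<open>f\<close>, back to \<open>w\<close> at the truncation
      \<open>g\<close>, on to \<open>v\<close> at \<open>g\<close>, and the size
      \<open>C * \<eta>\<close> of \<open>v\<close> at \<open>g\<close>. The summand 1 covers
      \<open>C = 0\<close>.\<close>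
    define \<eta> where "\<eta> = e / (4 * (C + 1))"
    have \<eta>: "0 < \<eta>" "C * \<eta> \<le> e / 4" "\<eta> \<le> e / 4"
      using e C(1) by (simp_all add: \<eta>_def field_simps)
    obtain B \<mu> where \<mu>: "\<mu> \<in> lip_free B" "norm (w - \<mu>) \<le> \<eta>" "\<And>x. x \<in> B \<Longrightarrow> infdist x K \<le> \<eta>"
      using approx[OF \<eta>(1)] by blast
    have "1-lipschitz_on UNIV (\<lambda>x. max (- \<eta>) (min \<eta> (lip0_apply f x)))"
    proof (rule lipschitz_onI)
      fix x y
      show "dist (max (- \<eta>) (min \<eta> (lip0_apply f x))) (max (- \<eta>) (min \<eta> (lip0_apply f y)))
          \<le> 1 * dist x y"
        using lip[of x y] \<eta>(1) unfolding dist_real_def by linarith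
    qed simp
    then obtain g where g: "\<And>x. lip0_apply g x = max (- \<eta>) (min \<eta> (lip0_apply f x))" "norm g \<le> 1"
      using obtain_lip0[of 1 "\<lambda>x. max (- \<eta>) (min \<eta> (lip0_apply f x))"] \<eta>(1) by auto
    have bound: "\<bar>blinfun_apply (w - \<nu>) h\<bar> \<le> norm (w - \<nu>)" if "norm h \<le> 1" for \<nu> h
      using norm_blinfun[of "w - \<nu>" h] mult_left_mono[OF that, of "norm (w - \<nu>)"] by simp
    have "blinfun_apply \<mu> f = blinfun_apply \<mu> g"
    proof (rule lip_free_cong[OF \<mu>(1)])
      fix x assume "x \<in> B"
      with f_le[of x] \<mu>(3)[of x] show "lip0_apply f x = lip0_apply g x"
        by (auto simp: g(1))
    qed
    moreover have "\<bar>blinfun_apply v g\<bar> \<le> C * \<eta>"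
      using \<eta>(1) by (intro C(2)) (auto simp: g(1))
    ultimately have "blinfun_apply w f \<le> e"
      using bound[OF f(1), of \<mu>] bound[OF g(2), of \<mu>] bound[OF g(2), of v] \<mu>(2) v(2) \<eta>
      by (simp add: blinfun.diff_left)
    with f(3) show ?thesis by simp
  qed
  have "infdist w (lip_free K) \<le> 0"
    by (rule field_le_epsilon) (use small in simp)
  then have "infdist w (lip_free K) = 0"
    using infdist_nonneg[of w "lip_free K"] by linarith
  then show ?thesis
    using in_closed_iff_infdist_zero[OF closed_lip_free lip_free_nonempty] by blast
qed

text \<open>The triangular condition covers points of the intersection as well as points taken from
  successive stages. Since \<open>\<delta> 0 < 1\<close>, the first neighbourhood bounds the
  sequence; the conic widths then become uniformly small and the finite sets provide nets.\<close>

lemma conic_nbhd_shrinking_convergent: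
  fixes E :: "nat \<Rightarrow> 'a::{complete_space, pointed_metric_space} set"
  assumes fin: "\<And>k. finite (E k)" and ne: "\<And>k. E k \<noteq> {}"
    and \<delta>: "\<delta> \<longlonglongrightarrow> 0" and \<delta>0: "0 \<le> \<delta> 0" "\<delta> 0 < 1"
    and x: "\<And>j k. j < k \<Longrightarrow> x k \<in> conic_nbhd (\<delta> j) (E j)"
  obtains l r where "strict_mono (r :: nat \<Rightarrow> nat)" "(x \<circ> r) \<longlonglongrightarrow> l"
proof -
  have near: "\<exists>a\<in>E j. dist (x k) a \<le> \<delta> j * (1 + dist (x k) base_point)" if jk: "j < k" for j k
  proof -
    have "Min (dist (x k) ` E j) \<in> dist (x k) ` E j"
      using fin ne by (intro Min_in) auto
    moreover have "infdist (x k) (E j) = Min (dist (x k) ` E j)"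
      using fin ne by (simp add: infdist_notempty cInf_eq_Min)
    ultimately show ?thesis
      using x[OF jk] by (auto simp: conic_nbhd_def)
  qed
  define m where "m = Max ((\<lambda>a. dist a base_point) ` E 0)"
  have bounded: "(1 + dist (x k) base_point) \<le> (1 + m) / (1 - \<delta> 0)" if k: "0 < k" for k
  proof -
    obtain a where a: "a \<in> E 0" "dist (x k) a \<le> \<delta> 0 * (1 + dist (x k) base_point)"
      using near[OF k] by blast
    have "dist a base_point \<le> m"
      unfolding m_def using a(1) fin by (intro Max_ge) auto
    then have "(1 + dist (x k) base_point) * (1 - \<delta> 0) \<le> 1 + m"
      using a(2) dist_triangle[of "x k" base_point a] by (simp add: algebra_simps)
    with \<delta>0 show ?thesis
      by (simp add: pos_le_divide_eq)
  qed
  define R where "R = (1 + m) / (1 - \<delta> 0)"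
  have R: "0 < R"
    unfolding R_def using bounded[of 1] by (rule less_le_trans[rotated]) (simp_all add: add_pos_nonneg)
  have tot: "\<exists>F. finite F \<and> closure (range x) \<subseteq> (\<Union>a\<in>F. ball a e)" if e: "0 < e" for e
  proof -
    have "eventually (\<lambda>j. dist (\<delta> j) 0 < e / (2 * R)) sequentially"
      using \<delta> by (rule tendstoD) (use e R in simp)
    then obtain j where "\<bar>\<delta> j\<bar> < e / (2 * R)"
      by (auto simp: eventually_sequentially dist_real_def)
    then have j: "\<bar>\<delta> j\<bar> * R < e / 2"
      using R by (simp add: field_simps)
    \<comment> \<open>Level \<open>j\<close> constrains only the points with \<open>k > j\<close>,
      so the earlier ones are added to the net.\<close>
    let ?F = "E j \<union> x ` {..j}"
    have "range x \<subseteq> (\<Union>a\<in>?F. cball a (e / 2))"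
    proof safe
      fix k
      show "x k \<in> (\<Union>a\<in>?F. cball a (e / 2))"
      proof (cases "k \<le> j")
        case True
        with e show ?thesis by (intro UN_I[of "x k"]) auto
      next
        case False
        then obtain a where a: "a \<in> E j" "dist (x k) a \<le> \<delta> j * (1 + dist (x k) base_point)"
          using near[of j k] by auto
        note a(2)
        also have "\<delta> j * (1 + dist (x k) base_point) \<le> \<bar>\<delta> j\<bar> * R"
          using bounded[of k] False R unfolding R_def[symmetric] by (intro mult_mono) auto
        also note j
        finally show ?thesis
          using a(1) by (intro UN_I[of a]) (auto simp: dist_commute)
      qed
    qed
    then have "closure (range x) \<subseteq> (\<Union>a\<in>?F. cball a (e / 2))"
      using fin by (intro closure_minimal closed_UN) auto
    also have "\<dots> \<subseteq> (\<Union>a\<in>?F. ball a e)"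
      using e by (intro UN_mono) auto
    finally show ?thesis
      using fin by (intro exI[of _ ?F]) auto
  qed
  have "compact (closure (range x))"
    unfolding compact_eq_totally_bounded using tot by (simp add: complete_eq_closed)
  then obtain l r where "strict_mono r" "(x \<circ> r) \<longlonglongrightarrow> l"
    unfolding compact_def using closure_subset[of "range x"] by (metis rangeI subsetD)
  then show thesis
    by (rule that)
qed

theorem weakly_null_compact_reduction:
  fixes u :: "nat \<Rightarrow> 'a::{complete_space, pointed_metric_space} lip0 \<Rightarrow>\<^sub>L real"
  assumes u: "range u \<subseteq> lip_free UNIV"
    and null: "\<And>f. (\<lambda>n. blinfun_apply (u n) f) \<longlonglongrightarrow> 0"
    and \<epsilon>: "0 < \<epsilon>"
  shows "\<exists>K w. compact K \<and> range w \<subseteq> lip_free K \<and>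
    (\<forall>f. (\<lambda>n. blinfun_apply (w n) f) \<longlonglongrightarrow> 0) \<and> (\<forall>n. norm (w n - u n) \<le> 2 * \<epsilon>)"
proof -
  \<comment> \<open>The sequence starts at \<open>1 / 2\<close> because boundedness requires
    \<open>\<delta> 0 < 1\<close>.\<close>
  define \<delta> :: "nat \<Rightarrow> real" where "\<delta> k = 1 / (real k + 2)" for k
  have \<delta>_pos: "0 < \<delta> k" for k
    by (simp add: \<delta>_def)
  have \<delta>_lim: "\<delta> \<longlonglongrightarrow> 0"
    unfolding \<delta>_def by real_asymp
  let ?I = "\<lambda>k (U :: nat \<Rightarrow> 'a lip0 \<Rightarrow>\<^sub>L real, A). range U \<subseteq> lip_free A \<and>
    (\<forall>f. (\<lambda>n. blinfun_apply (U n) f) \<longlonglongrightarrow> 0) \<and> (k = (0::nat) \<longrightarrow> U = u \<and> A = UNIV)"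
  let ?R = "\<lambda>k (U, A) (U' :: nat \<Rightarrow> 'a lip0 \<Rightarrow>\<^sub>L real, A').
    (\<exists>E. finite E \<and> base_point \<in> E \<and> A' = A \<inter> conic_nbhd (\<delta> k) E) \<and>
    (\<forall>n. norm (U' n - U n) \<le> \<epsilon> * (1 / 2) ^ k)"
  have "\<exists>s. \<forall>k. ?I k (s k) \<and> ?R k (s k) (s (Suc k))"
  proof (rule dependent_nat_choice)
    show "\<exists>s. ?I 0 s"
      using u null by (intro exI[of _ "(u, UNIV)"]) simp
    fix s :: "(nat \<Rightarrow> 'a lip0 \<Rightarrow>\<^sub>L real) \<times> 'a set" and k
    assume "?I k s"
    then obtain U A where s: "s = (U, A)" and U: "range U \<subseteq> lip_free A"
      "\<And>f. (\<lambda>n. blinfun_apply (U n) f) \<longlonglongrightarrow> 0"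
      by (cases s) auto
    have "0 < \<epsilon> * (1 / 2) ^ k"
      using \<epsilon> by simp
    then obtain E U' where E: "finite E" "base_point \<in> E"
      and U': "range U' \<subseteq> lip_free (A \<inter> conic_nbhd (\<delta> k) E)"
        "\<And>f. (\<lambda>n. blinfun_apply (U' n) f) \<longlonglongrightarrow> 0"
        "\<And>n. norm (U' n - U n) \<le> \<epsilon> * (1 / 2) ^ k"
      by (rule weakly_null_cutoff[OF U \<delta>_pos[of k]]) (rule that)
    have "?I (Suc k) (U', A \<inter> conic_nbhd (\<delta> k) E)"
      using U' by simp
    moreover have "?R k s (U', A \<inter> conic_nbhd (\<delta> k) E)"
      using E U'(3) unfolding s by auto
    ultimately have "?I (Suc k) (U', A \<inter> conic_nbhd (\<delta> k) E) \<and> ?R k s (U', A \<inter> conic_nbhd (\<delta> k) E)"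
      by (rule conjI)
    then show "\<exists>t. ?I (Suc k) t \<and> ?R k s t" ..
  qed
  then obtain s where s: "\<forall>k. ?I k (s k) \<and> ?R k (s k) (s (Suc k))" ..
  define U A where "U k = fst (s k)" and "A k = snd (s k)" for k
  have s_eq: "s k = (U k, A k)" for k
    by (simp add: U_def A_def)
  note I = s[THEN spec, THEN conjunct1, unfolded s_eq prod.case]
  note R = s[THEN spec, THEN conjunct2, unfolded s_eq prod.case]
  have U_in: "range (U k) \<subseteq> lip_free (A k)" for k
    using I[of k] by blast
  have U_null: "(\<lambda>n. blinfun_apply (U k n) f) \<longlonglongrightarrow> 0" for k f
    using I[of k] by blast
  have U0: "U 0 = u" and A0: "A 0 = UNIV"
    using I[of 0] by simp_all
  have step: "norm (U (Suc k) n - U k n) \<le> \<epsilon> * (1 / 2) ^ k" for k n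
    using R[of k] by blast
  have "\<forall>k. \<exists>E. finite E \<and> base_point \<in> E \<and> A (Suc k) = A k \<inter> conic_nbhd (\<delta> k) E"
    using R by blast
  then obtain E where E: "\<forall>k. finite (E k) \<and> base_point \<in> E k \<and>
      A (Suc k) = A k \<inter> conic_nbhd (\<delta> k) (E k)"
    by (rule choice[THEN exE])
  have A_eq: "A k = (\<Inter>j<k. conic_nbhd (\<delta> j) (E j))" for k
    using E by (induction k) (auto simp: A0 lessThan_Suc)
  define K where "K = (\<Inter>j. conic_nbhd (\<delta> j) (E j))"
  have bK: "base_point \<in> K"
    using E subset_conic_nbhd[OF less_imp_le[OF \<delta>_pos]] by (fastforce simp: K_def)
  \<comment> \<open>Allowing \<open>x k\<close> in \<open>A k\<close> rather than in
    \<open>K\<close> serves two purposes: compactness of \<open>K\<close>, and the shrinking of the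
    stages to \<open>K\<close>.\<close>
  have converge: "\<exists>l\<in>K. \<exists>r. strict_mono (r :: nat \<Rightarrow> nat) \<and> (x \<circ> r) \<longlonglongrightarrow> l"
    if x: "\<forall>k. x k \<in> A k" for x
  proof -
    have x_in: "x k \<in> conic_nbhd (\<delta> j) (E j)" if "j < k" for j k
      using x that by (auto simp: A_eq)
    have fin: "finite (E k)" and ne: "E k \<noteq> {}" for k
      using E by auto
    have \<delta>0: "0 \<le> \<delta> 0" "\<delta> 0 < 1"
      by (simp_all add: \<delta>_def)
    obtain l r where r: "strict_mono r" and lim: "(x \<circ> r) \<longlonglongrightarrow> l"
      using conic_nbhd_shrinking_convergent[where x = x and E = E, OF fin ne \<delta>_lim \<delta>0 x_in] by blast
    have "l \<in> conic_nbhd (\<delta> j) (E j)" for j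
    proof (rule Lim_in_closed_set[OF closed_conic_nbhd _ _ lim])
      have "x (r k) \<in> conic_nbhd (\<delta> j) (E j)" if "Suc j \<le> k" for k
        using seq_suble[OF r, of k] that by (intro x_in) simp
      then show "eventually (\<lambda>k. (x \<circ> r) k \<in> conic_nbhd (\<delta> j) (E j)) sequentially"
        unfolding eventually_sequentially comp_def by blast
    qed simp
    then have "l \<in> K"
      by (simp add: K_def)
    with r lim show ?thesis by blast
  qed
  have "compact K"
    unfolding compact_def
  proof (intro allI impI)
    fix x :: "nat \<Rightarrow> 'a"
    assume "\<forall>n. x n \<in> K"
    then have "\<forall>n. x n \<in> A n"
      by (auto simp: K_def A_eq)
    then show "\<exists>l\<in>K. \<exists>r. strict_mono r \<and> (x \<circ> r) \<longlonglongrightarrow> l"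
      by (rule converge)
  qed
  \<comment> \<open>Otherwise points of the stages at distance at least \<open>\<eta>\<close> from
    \<open>K\<close> would have a subsequence converging into \<open>K\<close>.\<close>
  have shrink: "\<exists>k. \<forall>x\<in>A k. infdist x K \<le> \<eta>" if \<eta>: "0 < \<eta>" for \<eta>
  proof (rule ccontr)
    assume "\<not> ?thesis"
    then have "\<forall>k. \<exists>x. x \<in> A k \<and> \<eta> \<le> infdist x K"
      by (auto simp: not_le intro: less_imp_le)
    then obtain x where x: "\<forall>k. x k \<in> A k \<and> \<eta> \<le> infdist (x k) K"
      by (rule choice[THEN exE])
    then obtain l r where l: "l \<in> K" and lim: "(x \<circ> r) \<longlonglongrightarrow> l"
      using converge[of x] by blast
    have "(\<lambda>k. infdist ((x \<circ> r) k) K) \<longlonglongrightarrow> infdist l K"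
      using lim by (rule tendsto_infdist)
    then have "\<eta> \<le> infdist l K"
      by (rule LIMSEQ_le_const) (use x in auto)
    with l \<eta> show False by simp
  qed
  have "\<forall>n. \<exists>l. \<forall>k. norm (l - U k n) \<le> 2 * \<epsilon> * (1 / 2) ^ k"
  proof
    fix n
    show "\<exists>l. \<forall>k. norm (l - U k n) \<le> 2 * \<epsilon> * (1 / 2) ^ k"
      using geometric_Cauchy_limit[where x = "\<lambda>k. U k n", OF step] by blast
  qed
  then obtain w where w: "\<forall>n. \<forall>k. norm (w n - U k n) \<le> 2 * \<epsilon> * (1 / 2) ^ k"
    by (rule choice[THEN exE])
  have small: "\<exists>m. \<forall>k\<ge>m. \<forall>n. norm (w n - U k n) < \<eta>" if \<eta>: "0 < \<eta>" for \<eta>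
  proof -
    have "(\<lambda>k. 2 * \<epsilon> * (1 / 2) ^ k) \<longlonglongrightarrow> 2 * \<epsilon> * 0"
      by (intro tendsto_mult_left LIMSEQ_power_zero) simp
    then have "eventually (\<lambda>k. 2 * \<epsilon> * (1 / 2) ^ k < \<eta>) sequentially"
      by (rule order_tendstoD) (use \<eta> in simp)
    with w show ?thesis
      unfolding eventually_sequentially by (meson order_le_less_trans)
  qed
  have w_UNIV: "w n \<in> lip_free UNIV" for n
  proof -
    have "\<exists>y\<in>lip_free UNIV. dist y (w n) < \<eta>" if \<eta>: "0 < \<eta>" for \<eta>
    proof -
      obtain k where "norm (w n - U k n) < \<eta>"
        using small[OF \<eta>] by blast
      moreover have "U k n \<in> lip_free UNIV"
        using U_in[of k] lip_free_mono[of "A k" UNIV] by blast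
      ultimately show ?thesis
        by (intro bexI[of _ "U k n"]) (simp_all add: dist_norm norm_minus_commute)
    qed
    then show ?thesis
      using closed_approachable[OF closed_lip_free] by blast
  qed
  have "w n \<in> lip_free K" for n
  proof (rule lip_free_limit_of_shrinking_supports[OF w_UNIV bK])
    fix \<eta> :: real assume \<eta>: "0 < \<eta>"
    obtain m where m: "\<And>k. m \<le> k \<Longrightarrow> norm (w n - U k n) < \<eta>"
      using small[OF \<eta>] by blast
    obtain k where k: "\<And>x. x \<in> A k \<Longrightarrow> infdist x K \<le> \<eta>"
      using shrink[OF \<eta>] by blast
    have "A (max m k) \<subseteq> A k"
      by (auto simp: A_eq)
    moreover have "U (max m k) n \<in> lip_free (A (max m k))"
      using U_in by blast
    ultimately show "\<exists>B \<mu>. \<mu> \<in> lip_free B \<and> norm (w n - \<mu>) \<le> \<eta> \<and> (\<forall>x\<in>B. infdist x K \<le> \<eta>)"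
      using m[of "max m k"] k by (intro exI[of _ "A (max m k)"] exI[of _ "U (max m k) n"]) auto
  qed
  \<comment> \<open>\<open>U k\<close> approaches \<open>w\<close> uniformly in \<open>n\<close>,
    which permits the exchange of limits.\<close>
  moreover have "(\<lambda>n. blinfun_apply (w n) f) \<longlonglongrightarrow> 0" for f
  proof (rule LIMSEQ_I)
    fix e :: real assume e: "0 < e"
    define \<eta> where "\<eta> = e / (2 * (norm f + 1))"
    have \<eta>: "0 < \<eta>"
      unfolding \<eta>_def using e by (intro divide_pos_pos mult_pos_pos add_nonneg_pos) simp_all
    have \<eta>f: "\<eta> * (norm f + 1) = e / 2"
      using norm_ge_zero[of f] unfolding \<eta>_def by (simp add: add_nonneg_eq_0_iff field_simps)
    obtain k where k: "\<And>n. norm (w n - U k n) < \<eta>"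
      using small[OF \<eta>] by blast
    obtain m where m: "\<And>n. m \<le> n \<Longrightarrow> \<bar>blinfun_apply (U k n) f\<bar> < e / 2"
      using LIMSEQ_D[OF U_null[of k f], of "e / 2"] e by auto
    have "norm (blinfun_apply (w n) f - 0) < e" if n: "m \<le> n" for n
    proof -
      have "\<bar>blinfun_apply (w n) f - blinfun_apply (U k n) f\<bar> \<le> norm (w n - U k n) * norm f"
        using norm_blinfun[of "w n - U k n" f] by (simp add: blinfun.diff_left)
      also have "\<dots> \<le> \<eta> * (norm f + 1)"
        using k[of n] \<eta> by (intro mult_mono) auto
      finally show ?thesis
        using m[OF n] \<eta>f unfolding real_norm_def diff_0_right by linarith
    qed
    then show "\<exists>m. \<forall>n\<ge>m. norm (blinfun_apply (w n) f - 0) < e"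
      by blast
  qed
  moreover have "norm (w n - u n) \<le> 2 * \<epsilon>" for n
    using w[THEN spec, THEN spec, of n 0] by (simp add: U0)
  ultimately show ?thesis
    using \<open>compact K\<close> by blast
qed

text \<open>Both free subspaces use the same test functions, so a sequence weakly null in the
  smaller one is weakly null in the larger one.\<close>

lemma schur_property_lip_free_subset:
  assumes "schur_property (lip_free N)" "N' \<subseteq> N"
  shows "schur_property (lip_free N')"
  using assms lip_free_mono[OF assms(2)]
  by (auto simp: schur_property_def weakly_null_in_lip_free_iff)

theorem corollary2p6:
  shows "schur_property (lip_free (UNIV :: 'a::{complete_space, pointed_metric_space} set)) \<longleftrightarrow>
    (\<forall>K :: 'a set. compact K \<longrightarrow> schur_property (lip_free K))"
proof (intro iffI allI impI)
  fix K :: "'a set"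
  assume "schur_property (lip_free (UNIV :: 'a set))"
  then show "schur_property (lip_free K)"
    by (rule schur_property_lip_free_subset) simp
next
  assume schur: "\<forall>K :: 'a set. compact K \<longrightarrow> schur_property (lip_free K)"
  show "schur_property (lip_free (UNIV :: 'a set))"
    unfolding schur_property_def
  proof (intro allI impI)
    fix u :: "nat \<Rightarrow> 'a lip0 \<Rightarrow>\<^sub>L real"
    assume "weakly_null_in (lip_free UNIV) u"
    then have u: "range u \<subseteq> lip_free UNIV" "\<And>f. (\<lambda>n. blinfun_apply (u n) f) \<longlonglongrightarrow> 0"
      by (simp_all add: weakly_null_in_lip_free_iff)
    show "u \<longlonglongrightarrow> 0"
    proof (rule LIMSEQ_I)
      fix e :: real assume e: "0 < e"
      \<comment> \<open>\<open>K\<close> may depend on \<open>e\<close>, since each \<open>e\<close>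
        is treated separately. The approximation costs \<open>e / 2\<close> and the tail of
        \<open>w\<close> the other half.\<close>
      obtain K w where K: "compact K" and w: "range w \<subseteq> lip_free K"
        "\<forall>f. (\<lambda>n. blinfun_apply (w n) f) \<longlonglongrightarrow> 0"
        and wu: "\<And>n. norm (w n - u n) \<le> 2 * (e / 4)"
        using weakly_null_compact_reduction[OF u, of "e / 4"] e by auto
      have "weakly_null_in (lip_free K) w"
        using w by (simp add: weakly_null_in_lip_free_iff)
      with schur K have "w \<longlonglongrightarrow> 0"
        by (auto simp: schur_property_def)
      then obtain m where m: "\<And>n. m \<le> n \<Longrightarrow> norm (w n) < e / 2"
        using LIMSEQ_D[of w 0 "e / 2"] e by auto
      have "norm (u n - 0) < e" if n: "m \<le> n" for n
        using m[OF n] wu[of n] norm_triangle_ineq4[of "w n" "w n - u n"] by simp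
      then show "\<exists>m. \<forall>n\<ge>m. norm (u n - 0) < e"
        by blast
    qed
  qed
qed

end
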